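(* Let $\Gamma$ be a Shilla distance-regular graph with $b(\Gamma)=b$ and smallest eigenvalue $\theta_3$. Then $\theta_3<-b^2+2$ if and only if $b=2$.
   Context: A connected graph $\Gamma$ of diameter $D$ is distance-regular if there are integers $b_i,c_i$ ($0\le i\le D$) such that for any two vertices $x,y$ at distance $i$, exactly $c_i$ neighbours of $y$ are at distance $i-1$ from $x$ and exactly $b_i$ neighbours of $y$ are at distance $i+1$ from $x$. Then $\Gamma$ is regular of valency $k=b_0$, and $a_i:=k-b_i-c_i$. Its eigenvalues (of the adjacency matrix) are $k=\theta_0>\theta_1>\dots>\theta_D$. A Shilla distance-regular graph is a distance-regular graph of diameter $3$ whose second largest eigenvalue satisfies $\theta_1=a_3$; for such graphs $k=(a_3-a_1)a_3$ and $b(\Gamma):=a_3-a_1=k/a_3$. *)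

theory Defs
  imports Complex_Main
begin

definition simple_graph :: "'a set \<Rightarrow> ('a \<Rightarrow> 'a \<Rightarrow> bool) \<Rightarrow> bool" where
  "simple_graph V E \<longleftrightarrow> finite V \<and> V \<noteq> {} \<and>
     (\<forall>x y. E x y \<longrightarrow> x \<in> V \<and> y \<in> V) \<and>
     (\<forall>x y. E x y \<longrightarrow> E y x) \<and> (\<forall>x. \<not> E x x)"

inductive walk :: "'a set \<Rightarrow> ('a \<Rightarrow> 'a \<Rightarrow> bool) \<Rightarrow> nat \<Rightarrow> 'a \<Rightarrow> 'a \<Rightarrow> bool"
  for V E where
  walk0: "x \<in> V \<Longrightarrow> walk V E 0 x x"
| walkS: "walk V E n x y \<Longrightarrow> E y z \<Longrightarrow> z \<in> V \<Longrightarrow> walk V E (Suc n) x z"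

definition connected_graph :: "'a set \<Rightarrow> ('a \<Rightarrow> 'a \<Rightarrow> bool) \<Rightarrow> bool" where
  "connected_graph V E \<longleftrightarrow> (\<forall>x\<in>V. \<forall>y\<in>V. \<exists>n. walk V E n x y)"

definition gdist :: "'a set \<Rightarrow> ('a \<Rightarrow> 'a \<Rightarrow> bool) \<Rightarrow> 'a \<Rightarrow> 'a \<Rightarrow> nat" where
  "gdist V E x y = (LEAST n. walk V E n x y)"

definition diameter :: "'a set \<Rightarrow> ('a \<Rightarrow> 'a \<Rightarrow> bool) \<Rightarrow> nat" where
  "diameter V E = Max {gdist V E x y | x y. x \<in> V \<and> y \<in> V}"

text \<open>Distance-regular graph of diameter D with intersection numbers b_i, c_i (0 \<le> i \<le> D).
  For i = 0 the count for c_0 refers to neighbours at distance 0 (nat subtraction), which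
  is automatically 0, matching the convention c_0 = 0.\<close>
definition distance_regular ::
  "'a set \<Rightarrow> ('a \<Rightarrow> 'a \<Rightarrow> bool) \<Rightarrow> nat \<Rightarrow> (nat \<Rightarrow> nat) \<Rightarrow> (nat \<Rightarrow> nat) \<Rightarrow> bool" where
  "distance_regular V E D b c \<longleftrightarrow>
     simple_graph V E \<and> connected_graph V E \<and> diameter V E = D \<and>
     (\<forall>i\<le>D. \<forall>x\<in>V. \<forall>y\<in>V. gdist V E x y = i \<longrightarrow>
        card {z\<in>V. E y z \<and> gdist V E x z = i - 1} = c i \<and>
        card {z\<in>V. E y z \<and> gdist V E x z = i + 1} = b i)"

definition isect_a :: "(nat \<Rightarrow> nat) \<Rightarrow> (nat \<Rightarrow> nat) \<Rightarrow> nat \<Rightarrow> int" where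
  "isect_a b c i = int (b 0) - int (b i) - int (c i)"

definition adj_eigenvalue :: "'a set \<Rightarrow> ('a \<Rightarrow> 'a \<Rightarrow> bool) \<Rightarrow> real \<Rightarrow> bool" where
  "adj_eigenvalue V E \<theta> \<longleftrightarrow> (\<exists>f :: 'a \<Rightarrow> real. (\<exists>v\<in>V. f v \<noteq> 0) \<and>
      (\<forall>x\<in>V. (\<Sum>y\<in>{y\<in>V. E x y}. f y) = \<theta> * f x))"

definition adj_spectrum :: "'a set \<Rightarrow> ('a \<Rightarrow> 'a \<Rightarrow> bool) \<Rightarrow> real set" where
  "adj_spectrum V E = {\<theta>. adj_eigenvalue V E \<theta>}"

definition second_largest_eig :: "'a set \<Rightarrow> ('a \<Rightarrow> 'a \<Rightarrow> bool) \<Rightarrow> real" where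
  "second_largest_eig V E = Max (adj_spectrum V E - {Max (adj_spectrum V E)})"

definition smallest_eig :: "'a set \<Rightarrow> ('a \<Rightarrow> 'a \<Rightarrow> bool) \<Rightarrow> real" where
  "smallest_eig V E = Min (adj_spectrum V E)"

definition shilla :: "'a set \<Rightarrow> ('a \<Rightarrow> 'a \<Rightarrow> bool) \<Rightarrow> (nat \<Rightarrow> nat) \<Rightarrow> (nat \<Rightarrow> nat) \<Rightarrow> bool" where
  "shilla V E b c \<longleftrightarrow> distance_regular V E 3 b c \<and>
      second_largest_eig V E = real_of_int (isect_a b c 3)"

definition shilla_b :: "(nat \<Rightarrow> nat) \<Rightarrow> (nat \<Rightarrow> nat) \<Rightarrow> int" where
  "shilla_b b c = isect_a b c 3 - isect_a b c 1"

end

theory Submission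
  imports Defs "Jordan_Normal_Form.Schur_Decomposition"
begin

text \<open>
  Write \<open>a = a\<^sub>3\<close>, \<open>k = ab\<close>. Since \<open>a\<close> is an eigenvalue of the intersection matrix, \<open>b\<^sub>1 = (a+1)(b-1)\<close>,
  \<open>c\<^sub>3 = a(b-1)\<close>, and the two remaining eigenvalues are \<open>-(b+y)\<close> and \<open>y+S-b\<close>, where
  \<open>S = a+b-b\<^sub>2-c\<^sub>2\<close> and \<open>y\<close> is the positive root of \<open>y\<^sup>2 + Sy = (b-1)c\<^sub>2\<close>. Thus \<open>\<theta>\<^sub>3 = -(b+y) < -b\<close>,
  which settles \<open>b = 2\<close>, and for \<open>b \<ge> 3\<close> the bound \<open>y > b\<^sup>2-b-2\<close> has to be refuted.

  The Krein condition for \<open>\<theta>\<^sub>1, \<theta>\<^sub>1, \<theta>\<^sub>3\<close> reads \<open>y(b\<^sub>2+c\<^sub>2) \<le> (b\<^sup>2-b)b\<^sub>2\<close>, so \<open>y < b\<^sup>2-b\<close>. Counting the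
  common neighbours of a coclique of size \<open>b+1\<close> inside a neighbourhood gives
  \<open>2(a-b\<^sup>2+1) \<le> (c\<^sub>2-1)b(b+1)\<close>. The multiplicity of \<open>\<theta>\<^sub>3\<close>, the trace of an idempotent, is an integer; it
  is an explicit rational function of \<open>y\<close>. If \<open>y\<close> is irrational, the two conjugate multiplicities coincide, and
  comparing coefficients contradicts the Krein bound. Otherwise \<open>y = b\<^sup>2-b-1\<close>; then
  \<open>y\<close> divides \<open>c\<^sub>2\<close>, the coclique bound forces \<open>b = 3\<close> and \<open>c\<^sub>2 \<le> 25\<close>, and the finitely many remaining
  parameter sets violate integrality.
\<close>

section \<open>Traces of idempotents\<close>

text \<open>Every other term of the \<open>i\<close>-th diagonal entry of \<open>B * B\<close> has a
  factor below the diagonal, so each diagonal entry is its own square.\<close>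

lemma upper_triangular_idempotent_diag:
  fixes B :: "complex mat"
  assumes B: "B \<in> carrier_mat n n" and ut: "upper_triangular B" and id: "B * B = B" and i: "i < n"
  shows "B $$ (i,i) = 0 \<or> B $$ (i,i) = 1"
proof -
  have "(B * B) $$ (i,i) = (\<Sum>k<n. B $$ (i,k) * B $$ (k,i))"
    using B i by (simp add: scalar_prod_def lessThan_atLeast0)
  also have "\<dots> = (\<Sum>k<n. if k = i then B $$ (i,i) * B $$ (i,i) else 0)"
  proof (rule sum.cong[OF refl])
    fix k assume "k \<in> {..<n}"
    then have k: "k < n" by simp
    show "B $$ (i,k) * B $$ (k,i) = (if k = i then B $$ (i,i) * B $$ (i,i) else 0)"
    proof (cases k i rule: linorder_cases)
      case less
      then have "B $$ (i,k) = 0" using upper_triangularD[OF ut, of k i] i B by simp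
      then show ?thesis using less by simp
    next
      case equal then show ?thesis by simp
    next
      case greater
      then have "B $$ (k,i) = 0" using upper_triangularD[OF ut, of i k] k B by simp
      then show ?thesis using greater by simp
    qed
  qed
  also have "\<dots> = B $$ (i,i) * B $$ (i,i)" using i by simp
  finally have "B $$ (i,i) * B $$ (i,i) = B $$ (i,i)" using id by simp
  then show ?thesis by (auto simp: mult_cancel_left1)
qed

lemma sum_diag_mult_commute:
  fixes A B :: "'a :: comm_semiring_0 mat"
  assumes A: "A \<in> carrier_mat n n" and B: "B \<in> carrier_mat n n"
  shows "(\<Sum>i<n. (A * B) $$ (i,i)) = (\<Sum>i<n. (B * A) $$ (i,i))"
proof -
  have "(\<Sum>i<n. (A * B) $$ (i,i)) = (\<Sum>i<n. \<Sum>j<n. A $$ (i,j) * B $$ (j,i))"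
    using A B by (intro sum.cong) (auto simp: scalar_prod_def lessThan_atLeast0)
  also have "\<dots> = (\<Sum>j<n. \<Sum>i<n. B $$ (j,i) * A $$ (i,j))"
    by (subst sum.swap) (simp add: mult.commute)
  also have "\<dots> = (\<Sum>j<n. (B * A) $$ (j,j))"
    using A B by (intro sum.cong) (auto simp: scalar_prod_def lessThan_atLeast0)
  finally show ?thesis .
qed

text \<open>Schur triangularisation conjugates \<open>A\<close> to an upper triangular idempotent
  with the same trace, whose diagonal consists of zeros and ones.\<close>

lemma idempotent_mat_trace_nat:
  fixes A :: "complex mat"
  assumes A: "A \<in> carrier_mat n n" and id: "A * A = A"
  shows "\<exists>m::nat. (\<Sum>i<n. A $$ (i,i)) = of_nat m"
proof -
  obtain es where es: "char_poly A = (\<Prod>e\<leftarrow>es. [:- e, 1:])"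
    using char_poly_factorized[OF A] by blast
  obtain B P Q where BPQ: "schur_decomposition A es = (B,P,Q)"
    by (cases "schur_decomposition A es") auto
  from schur_decomposition[OF A es BPQ]
  have wit: "similar_mat_wit A B P Q" and ut: "upper_triangular B" by auto
  note w = similar_mat_witD2[OF A wit]
  have B: "B \<in> carrier_mat n n" and P: "P \<in> carrier_mat n n" and Q: "Q \<in> carrier_mat n n"
    and PQ: "P * Q = 1\<^sub>m n" and QP: "Q * P = 1\<^sub>m n" and AB: "A = P * B * Q" using w by auto
  have BA: "B = Q * A * P"
  proof -
    have "Q * A * P = Q * (P * B * Q) * P" by (simp only: AB[symmetric])
    also have "\<dots> = (Q * P) * B * (Q * P)"
      using B P Q by (simp add: assoc_mult_mat[of _ n n _ n _ n])
    also have "\<dots> = B" using QP B by simp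
    finally show ?thesis by (rule sym)
  qed
  have "B * B = (Q * A * P) * (Q * A * P)" by (simp only: BA[symmetric])
  also have "\<dots> = Q * (A * (P * Q) * A) * P"
    using A P Q by (simp add: assoc_mult_mat[of _ n n _ n _ n])
  also have "\<dots> = B" using A unfolding PQ BA by (simp add: id)
  finally have BB: "B * B = B" .
  have "(\<Sum>i<n. A $$ (i,i)) = (\<Sum>i<n. ((P * B) * Q) $$ (i,i))"
    by (simp only: AB[symmetric])
  also have "\<dots> = (\<Sum>i<n. (Q * (P * B)) $$ (i,i))"
    by (rule sum_diag_mult_commute[OF mult_carrier_mat[OF P B] Q])
  also have "Q * (P * B) = B" using left_mult_one_mat[OF B] by (simp only: assoc_mult_mat[OF Q P B, symmetric] QP)
  also have "(\<Sum>j<n. B $$ (j,j)) = (\<Sum>j<n. of_nat (if B $$ (j,j) = 1 then 1 else 0))"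
    by (intro sum.cong refl) (use upper_triangular_idempotent_diag[OF B ut BB] in force)
  also have "\<dots> = of_nat (\<Sum>j<n. if B $$ (j,j) = 1 then 1 else 0)" by (rule of_nat_sum[symmetric])
  finally show ?thesis by (rule exI)
qed

text \<open>The kernel is read as a complex matrix through an enumeration of \<open>V\<close>, since
  triangularisation needs a characteristic polynomial that splits.\<close>

lemma idempotent_kernel_trace_nat:
  fixes P :: "'a \<Rightarrow> 'a \<Rightarrow> real"
  assumes fin: "finite V"
    and id: "\<And>x y. x \<in> V \<Longrightarrow> y \<in> V \<Longrightarrow> (\<Sum>z\<in>V. P x z * P z y) = P x y"
  shows "\<exists>m::nat. (\<Sum>x\<in>V. P x x) = of_nat m"
proof -
  obtain h where h: "bij_betw h {..<card V} V"
    using ex_bij_betw_nat_finite[OF fin] by (auto simp: lessThan_atLeast0)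
  define n where "n = card V"
  have hV: "h i \<in> V" if "i < n" for i using h that by (auto simp: bij_betw_def n_def)
  define A where "A = mat n n (\<lambda>(i,j). complex_of_real (P (h i) (h j)))"
  have A: "A \<in> carrier_mat n n" by (simp add: A_def)
  have re: "(\<Sum>z\<in>V. f z) = (\<Sum>i<n. f (h i))" for f :: "'a \<Rightarrow> real"
    using sum.reindex_bij_betw[OF h, of f] by (simp add: n_def)
  have "A * A = A"
  proof (rule eq_matI)
    fix i j assume "i < dim_row A" "j < dim_col A"
    then have ij: "i < n" "j < n" using A by auto
    have "(A * A) $$ (i,j) = (\<Sum>k<n. complex_of_real (P (h i) (h k) * P (h k) (h j)))"
      using ij by (simp add: A_def scalar_prod_def lessThan_atLeast0)
    also have "\<dots> = complex_of_real (\<Sum>z\<in>V. P (h i) z * P z (h j))"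
      by (simp add: re)
    also have "\<dots> = A $$ (i,j)" using ij by (simp add: id hV A_def)
    finally show "(A * A) $$ (i,j) = A $$ (i,j)" .
  qed (use A in auto)
  from idempotent_mat_trace_nat[OF A this] obtain m :: nat
    where m: "(\<Sum>i<n. A $$ (i,i)) = of_nat m" by blast
  have "complex_of_real (\<Sum>x\<in>V. P x x) = (\<Sum>i<n. A $$ (i,i))"
    by (simp add: re A_def)
  then have "complex_of_real (\<Sum>x\<in>V. P x x) = complex_of_real (of_nat m)" using m by simp
  then show ?thesis using of_real_eq_iff by blast
qed

section \<open>Infeasible parameters\<close>

text \<open>The equation \<open>h3\<close> says that the multiplicity of \<open>-(b+y)\<close> is unchanged when \<open>y\<close> is
  replaced by the other root of \<open>y\<^sup>2 + Sy = P\<close>.\<close>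

lemma no_parameters_conjugate_root:
  fixes a b b2 c2 S K L P :: int
  assumes b: "b \<ge> 3" and a: "a \<ge> 1" and b2: "b2 \<ge> 1" and c2: "c2 \<ge> 1"
    and L: "L = a + b" and K: "K = a*b + b" and S: "S = L - b2 - c2" and P: "P = (b - 1) * c2"
    and h1: "c2 * (b^2 - b - 2) < 2 * b2"
    and h2: "S \<ge> 1 \<Longrightarrow> (b^2 - b - 2)^2 < P"
    and h3: "(K + L) * (S^2 + 2*P) = S * (S^2 + 3*P + K*L)"
  shows False
proof -
  have pos: "P > 0" "K > 0" "L > 0" using a b c2 by (auto simp: P K L add_pos_pos)
  have "0 < (K + L) * (S^2 + 2*P)" using pos by (intro mult_pos_pos) (auto intro: add_nonneg_pos)
  then have "0 < S * (S^2 + 3*P + K*L)" using h3 by simp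
  moreover have "0 < S^2 + 3*P + K*L" using pos by (auto intro!: add_nonneg_pos)
  ultimately have S1: "S \<ge> 1" using zero_less_mult_pos2[of S] by fastforce
  note h2 = h2[OF S1]
  have LS: "L - S = b2 + c2" by (simp add: S)
  have KL: "K - L = a * (b - 1)" by (simp add: K L algebra_simps)
  have KL1: "K - L \<ge> 2*a" unfolding KL using a b mult_left_mono[of 2 "b-1" a] by simp
  have KS: "K - S > 0" using KL1 a LS b2 c2 by linarith
  \<comment> \<open>\<open>h3\<close> in factored form: the terms free of \<open>P\<close> combine
    to \<open>S * (K - S) * (L - S)\<close>.\<close>
  have id: "P * (2*(K+L) - 3*S) = S * (K - S) * (b2 + c2)"
    using h3 by (simp add: LS[symmetric] algebra_simps power2_eq_square)
  have big: "c2 * (b * (b - 1)) < 2 * (b2 + c2)"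
    using h1 by (simp add: algebra_simps power2_eq_square)
  have "S * (K - S) * (c2 * (b * (b-1))) < S * (K - S) * (2 * (b2 + c2))"
    using big S1 KS by (intro mult_strict_left_mono) auto
  also have "\<dots> = 2 * (P * (2*(K+L) - 3*S))" using id by (simp add: algebra_simps)
  finally have "(c2 * (b-1)) * (b * (S * (K - S))) < (c2 * (b-1)) * (4*(K+L) - 6*S)"
    by (simp add: P algebra_simps)
  moreover have "c2 * (b-1) > 0" using c2 b by simp
  \<comment> \<open>Once \<open>a\<close> is large, the left side exceeds the right one unless
    \<open>S = 1\<close> and \<open>b\<close> is 3 or 4; those two cases fall to
    divisibility.\<close>
  ultimately have main: "b * (S * (K - S)) < 4*(K+L) - 6*S"
    by (simp only: mult_less_cancel_left_pos)
  \<comment> \<open>\<open>h2\<close> and \<open>big\<close> bound \<open>L\<close> from below,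
    which makes \<open>a\<close> large compared with \<open>b\<close>.\<close>
  have "2 + b * (b^2-b-2)^2 < 2 + b * P" using h2 b by simp
  also have "\<dots> = 2 + c2 * (b * (b-1))" by (simp add: P)
  also have "\<dots> < 2 + 2 * (b2 + c2)" using big by (rule add_strict_left_mono)
  also have "\<dots> \<le> 2 * L" using LS S1 by simp
  finally have Lbig: "2 + b * (b^2-b-2)^2 < 2 * L" .
  consider "b = 3" | "b = 4" | "b \<ge> 5" using b by linarith
  then show False
  proof cases
    case 1
    have a20: "a > 20" using Lbig unfolding L 1 by simp
    show False
    proof (cases "S = 1")
      case True
      \<comment> \<open>\<open>u\<close> is the cofactor of \<open>2 * c2\<close>. As
        \<open>64 * (3*a+2) * (a+2) = 3*u^2 + 10*u - 77\<close>, it divides 77, which is impossible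
        for \<open>a > 20\<close>.\<close>
      define u where "u = 8*a + 9"
      have "2 * c2 * (8*a+9) = (3*a+2) * (a+2)"
        using id LS unfolding True 1 P K L by (simp add: algebra_simps)
      then have "77 = u * (3*u + 10 - 128 * c2)"
        unfolding u_def by (simp add: algebra_simps)
      then have "u dvd 77" by (metis dvd_triv_left)
      then have "u \<le> 77" by (rule zdvd_imp_le) simp
      then show False using a20 by (simp add: u_def)
    next
      case False
      \<comment> \<open>For \<open>2 \<le> S \<le> L\<close> the product \<open>S * (K - S)\<close>
        is at least its value \<open>2 * (K - 2)\<close> at \<open>S = 2\<close>.\<close>
      then have "0 \<le> (S - 2) * (L - S)" using S1 LS b2 c2 by (intro mult_nonneg_nonneg) auto
      then have "S * (K - S) \<ge> S * (K - L - 2) + 2*L" by (simp add: algebra_simps)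
      moreover have "S * (K - L - 2) \<ge> 2 * (K - L - 2)"
        using False S1 KL1 a20 by (intro mult_right_mono) auto
      ultimately have "S * (K - S) \<ge> 2*K - 4" by simp
      then have "b * (2*K - 4) \<le> b * (S * (K - S))" using b by (intro mult_left_mono) auto
      then have "b * (2*K - 4) < 4*(K+L) - 6*S" using main by (rule le_less_trans)
      then show False using False S1 a20 unfolding 1 K L by simp
    qed
  next
    case 2
    have a20: "a > 150" using Lbig unfolding L 2 by simp
    show False
    proof (cases "S = 1")
      case True
      \<comment> \<open>Here \<open>100 * (4*a+3) * (a+3) = 4*u^2 + 46*u - 374\<close>, so
        \<open>u\<close> divides 374.\<close>
      define u where "u = 10*a + 13"
      have "3 * c2 * (10*a+13) = (4*a+3) * (a+3)"
        using id LS unfolding True 2 P K L by (simp add: algebra_simps)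
      then have "374 = u * (4*u + 46 - 300 * c2)"
        unfolding u_def by (simp add: algebra_simps)
      then have "u dvd 374" by (metis dvd_triv_left)
      then have "u \<le> 374" by (rule zdvd_imp_le) simp
      then show False using a20 by (simp add: u_def)
    next
      case False
      then have "0 \<le> (S - 2) * (L - S)" using S1 LS b2 c2 by (intro mult_nonneg_nonneg) auto
      then have "S * (K - S) \<ge> S * (K - L - 2) + 2*L" by (simp add: algebra_simps)
      moreover have "S * (K - L - 2) \<ge> 2 * (K - L - 2)"
        using False S1 KL1 a20 by (intro mult_right_mono) auto
      ultimately have "S * (K - S) \<ge> 2*K - 4" by simp
      then have "b * (2*K - 4) \<le> b * (S * (K - S))" using b by (intro mult_left_mono) auto
      then have "b * (2*K - 4) < 4*(K+L) - 6*S" using main by (rule le_less_trans)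
      then show False using False S1 a20 unfolding 2 K L by simp
    qed
  next
    case 3
    \<comment> \<open>The same estimate with left end \<open>S = 1\<close> gives
      \<open>S * (K - S) \<ge> K - 1\<close>, which suffices for \<open>b \<ge> 5\<close>.\<close>
    have "0 \<le> (S - 1) * (L - S)" using S1 LS b2 c2 by (intro mult_nonneg_nonneg) auto
    then have "S * (K - S) \<ge> S * (K - L - 1) + L" by (simp add: algebra_simps)
    moreover have "S * (K - L - 1) \<ge> 1 * (K - L - 1)"
      using S1 KL1 a by (intro mult_right_mono) auto
    ultimately have "S * (K - S) \<ge> K - 1" by simp
    then have "b * (S * (K - S)) \<ge> b * (K - 1)" using b by (intro mult_left_mono) auto
    moreover have "b * (K - 1) \<ge> 5 * (K - 1)" using 3 pos by (intro mult_right_mono) auto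
    ultimately have "5 * (K - 1) < 4*(K+L) - 6*S" using main by (meson le_less_trans)
    then have KL4: "K < 4 * L" using S1 by simp
    have "b^2 - b - 2 \<ge> 18"
      using mult_mono[of 3 "b-2" 6 "b+1"] 3 by (simp add: algebra_simps power2_eq_square)
    then have "(b^2 - b - 2)^2 \<ge> 18^2" by (intro power_mono) auto
    then have "b * 324 \<le> b * (b^2 - b - 2)^2" using b by (intro mult_left_mono) auto
    also have "\<dots> < 2 * L" using Lbig by simp
    finally have "a > 100 * b" using b unfolding L by simp
    moreover have "K \<ge> a * 5" unfolding K using mult_left_mono[of 5 b a] 3 a by linarith
    ultimately show False using KL4 b L by (smt (verit))
  qed
qed

text \<open>The Krein bound leaves only \<open>y = b^2 - b - 1\<close>. With
  \<open>c2 = y * m\<close> the root equation determines \<open>a\<close>, and the coclique bound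
  together with \<open>b2 \<ge> m * y^2\<close> bounds \<open>m\<close>.\<close>

lemma no_parameters_integral_root:
  fixes a b b2 c2 y n k2 k3 :: int
  assumes b: "b \<ge> 3" and a: "a \<ge> 1" and b2: "b2 \<ge> 1" and c2: "c2 \<ge> 1"
    and ylow: "y > b^2 - b - 2"
    and root: "y^2 + (a + b - b2 - c2) * y = (b - 1) * c2"
    and krein: "y * (b2 + c2) \<le> (b^2 - b) * b2"
    and claw: "2 * (a - b^2 + 1) \<le> (c2 - 1) * (b * (b + 1))"
    and k2: "k2 * c2 = a * b * (a + 1) * (b - 1)"
    and k3: "k3 * c2 = b * (a + 1) * b2"
    and mult: "n * ((a*b + b + y) * (a + b + y) * (a + b - b2 - c2 + 2*y))
        = (1 + a*b + k2 + k3) * (a * b * (a + 1) * (a + b - b2 - c2 + y))"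
  shows False
proof -
  have bb: "b^2 - b - 2 \<ge> 4"
    using mult_mono[of 1 "b-2" 4 "b+1"] b by (simp add: algebra_simps power2_eq_square)
  have ypos: "y > 0" using ylow bb by linarith
  have "y < b^2 - b"
  proof (rule ccontr)
    assume "\<not> y < b^2 - b"
    then have "(b^2 - b) * (b2 + c2) \<le> y * (b2 + c2)" using b2 c2 by (intro mult_right_mono) auto
    with krein have "(b^2 - b) * c2 \<le> 0" by (simp add: algebra_simps)
    moreover have "(b^2 - b) * c2 > 0" using bb c2 by (intro mult_pos_pos) auto
    ultimately show False by simp
  qed
  with ylow have y: "y = b^2 - b - 1" by linarith
  have "y * (b2 + c2) \<le> (y + 1) * b2" using krein y by simp
  then have kr: "y * c2 \<le> b2" by (simp add: algebra_simps)
  have "y * (y + (a + b - b2 - c2)) = (b-1) * c2" using root by (simp add: algebra_simps power2_eq_square)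
  then have "y dvd (b-1) * c2" by (metis dvd_triv_left)
  moreover have "coprime y (b-1)"
  proof -
    have "y = b * (b - 1) - 1" by (simp add: y algebra_simps power2_eq_square)
    then have "gcd y (b-1) dvd 1"
      by (metis dvd_diff_commute dvd_minus_iff dvd_mult gcd_dvd1 gcd_dvd2 diff_diff_eq2 add_diff_cancel_left' dvd_diff)
    then show ?thesis by (simp add: coprime_iff_gcd_eq_1)
  qed
  ultimately have "y dvd c2" by (simp add: coprime_dvd_mult_right_iff)
  then obtain m where m: "c2 = y * m" by (elim dvdE)
  have m1: "m \<ge> 1" using c2 ypos unfolding m by (metis int_one_le_iff_zero_less less_le_trans zero_less_mult_pos zero_less_one)
  have "y * (y + (a + b - b2 - c2)) = y * ((b-1) * m)"
    using root unfolding m by (simp add: algebra_simps power2_eq_square)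
  then have yS: "y + (a + b - b2 - c2) = (b-1) * m" using ypos by simp
  then have aeq: "a = (b-1) * m - y - b + b2 + y * m" by (simp add: m)
  have b2m: "b2 \<ge> m * y^2" using kr by (simp add: m power2_eq_square algebra_simps)
  have bsq: "b^2 = y + b + 1" by (simp add: y)
  have "2 * ((b-1) * m - y - b + m * y^2 + y * m - y - b) \<le> 2 * (a - b^2 + 1)"
    using b2m unfolding aeq bsq by simp
  also note claw
  also have "(c2 - 1) * (b * (b+1)) = (y * m - 1) * (y + 2 * b + 1)"
    by (simp add: m y algebra_simps power2_eq_square)
  \<comment> \<open>For \<open>b \<ge> 4\<close> the coefficient of \<open>m\<close> already exceeds
    the right side. For \<open>b = 3\<close>, \<open>y = 5\<close> it is 4 against 20, whence
    \<open>m \<le> 5\<close>.\<close>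
  finally have key: "m * (y^2 + y + 2 * b - 2 - 2 * (b * y)) \<le> 3 * y + 2 * b - 1"
    by (simp add: algebra_simps power2_eq_square)
  have b3: "b = 3"
  proof (rule ccontr)
    assume "b \<noteq> 3"
    then have b4: "b \<ge> 4" using b by simp
    have "y * (b^2 - 3 * b) \<ge> y * 4"
      using mult_mono[of 4 b 1 "b-3"] b4 ypos by (intro mult_left_mono) (auto simp: algebra_simps power2_eq_square)
    moreover have "y * (b^2 - 3*b) = y^2 + y - 2 * (b * y)"
      unfolding bsq by (simp add: power2_eq_square algebra_simps)
    ultimately have "y^2 + y + 2 * b - 2 - 2 * (b * y) \<ge> 4 * y + 2 * b - 2" by simp
    moreover have "m * (y^2 + y + 2 * b - 2 - 2 * (b * y)) \<ge> 1 * (y^2 + y + 2 * b - 2 - 2 * (b * y))"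
      using m1 ypos b calculation by (intro mult_right_mono) auto
    ultimately have "4 * y + 2 * b - 2 \<le> 3 * y + 2 * b - 1" using key
      unfolding mult_1 by (meson order_trans)
    then show False using bb ylow by simp
  qed
  have y5: "y = 5" by (simp add: y b3)
  have m5: "m \<le> 5" using key by (simp add: y5 b3)
  have c2m: "c2 = 5 * m" by (simp add: m y5)
  have am: "a = b2 + 7 * m - 8" using aeq by (simp add: y5 b3)
  have lo: "25 * m \<le> b2" using b2m by (simp add: y5)
  have hi: "b2 \<le> 23 * m + 10" using claw by (simp add: c2m am b3)
  \<comment> \<open>Integrality of \<open>k2\<close>, \<open>k3\<close> and \<open>n\<close> as
    divisibilities, which involve only \<open>m\<close> and \<open>b2\<close> after substituting
    \<open>am\<close>; the equation for \<open>n\<close> is multiplied by \<open>c2\<close> to clear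
    the denominators of \<open>k2\<close> and \<open>k3\<close>.\<close>
  have d1: "5 * m dvd a * 3 * (a + 1) * 2" using dvd_triv_right[of c2 k2] unfolding k2 by (simp add: c2m b3)
  have d2: "5 * m dvd 3 * (a + 1) * b2" using dvd_triv_right[of c2 k3] unfolding k3 by (simp add: c2m b3)
  have "n * (5 * m * ((a*3 + 8) * (a + 8) * (2*m + 5)))
      = ((1 + a*3) * (5 * m) + k2 * c2 + k3 * c2) * (a * 3 * (a + 1) * (2 * m))"
    using arg_cong[OF mult, of "\<lambda>u. u * c2"] by (simp add: c2m am b3 y5 algebra_simps)
  then have "n * (5 * m * ((a*3 + 8) * (a + 8) * (2*m + 5)))
      = ((1 + a*3) * (5 * m) + a * 3 * (a + 1) * 2 + 3 * (a + 1) * b2) * (a * 3 * (a + 1) * (2 * m))"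
    unfolding k2 k3 b3 by simp
  then have d3: "5 * m * ((a*3 + 8) * (a + 8) * (2*m + 5)) dvd
      ((1 + a*3) * (5 * m) + a * 3 * (a + 1) * 2 + 3 * (a + 1) * b2) * (a * 3 * (a + 1) * (2 * m))"
    by (metis dvd_triv_right)
  note d1 = d1[unfolded am] and d2 = d2[unfolded am] and d3 = d3[unfolded am]
  have "m \<in> {1,2,3,4,5}" using m1 m5 by auto
  then show False
  proof (elim insertE emptyE)
    assume m: "m = 1"
    have "b2 \<in> {25..33}" using lo hi by (simp add: m)
    also have "{25..33} = {25,26,27,28,29,30,31,32,33::int}" by auto
    finally show False using d1 d2 d3 unfolding m by - (elim insertE emptyE; simp)
  next
    assume m: "m = 2"
    have "b2 \<in> {50..56}" using lo hi by (simp add: m)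
    also have "{50..56} = {50,51,52,53,54,55,56::int}" by auto
    finally show False using d1 d2 d3 unfolding m by - (elim insertE emptyE; simp)
  next
    assume m: "m = 3"
    have "b2 \<in> {75..79}" using lo hi by (simp add: m)
    also have "{75..79} = {75,76,77,78,79::int}" by auto
    finally show False using d1 d2 d3 unfolding m by - (elim insertE emptyE; simp)
  next
    assume m: "m = 4"
    have "b2 \<in> {100..102}" using lo hi by (simp add: m)
    also have "{100..102} = {100,101,102::int}" by auto
    finally show False using d1 d2 d3 unfolding m by - (elim insertE emptyE; simp)
  next
    assume m: "m = 5"
    have "b2 \<in> {125..125}" using lo hi by (simp add: m)
    also have "{125..125} = {125::int}" by auto
    finally show False using d1 d2 d3 unfolding m by - (elim insertE emptyE; simp)
  qed
qed

text \<open>Modulo \<open>y^2 = P - S * y\<close> the multiplicity equation becomes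
  \<open>A + B * y = 0\<close> with integers \<open>A\<close>, \<open>B\<close>. If
  \<open>B = 0\<close>, both roots of the quadratic satisfy it; otherwise \<open>y\<close> is a
  rational algebraic integer, hence an integer.\<close>

lemma no_parameters_below_bound:
  fixes a b b2 c2 n k2 k3 :: int and y :: real
  assumes b: "b \<ge> 3" and a: "a \<ge> 1" and b2: "b2 \<ge> 1" and c2: "c2 \<ge> 1"
    and ylow: "y > b^2 - b - 2"
    and root: "y^2 + (a + b - b2 - c2) * y = (b - 1) * c2"
    and krein: "y * (b2 + c2) \<le> (b^2 - b) * b2"
    and claw: "2 * (a - b^2 + 1) \<le> (c2 - 1) * (b * (b + 1))"
    and k2: "k2 * c2 = a * b * (a + 1) * (b - 1)"
    and k3: "k3 * c2 = b * (a + 1) * b2"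
    and mult: "n * ((a*b + b + y) * (a + b + y) * (a + b - b2 - c2 + 2*y))
        = (1 + a*b + k2 + k3) * (a * b * (a + 1) * (a + b - b2 - c2 + y))"
  shows False
proof -
  define K L S P where KLSP: "K = a*b + b" "L = a + b" "S = L - b2 - c2" "P = (b - 1) * c2"
  define X where "X = (1 + a*b + k2 + k3) * (a * b * (a + 1))"
  define A where "A = n * (S*(K*L+P) + 2*P*(K+L-S)) - X * S"
  define B where "B = n * (2*K*L + 2*P - S*(K+L-S)) - X"
  have bb: "b^2 - b - 2 \<ge> 4"
    using mult_mono[of 1 "b-2" 4 "b+1"] b by (simp add: algebra_simps power2_eq_square)
  have ypos: "y > 0" using ylow bb by linarith
  have Ppos: "P > 0" using b c2 by (simp add: KLSP)
  have root': "y^2 = P - S * y" using root by (simp add: KLSP)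
  have "real_of_int n * ((K + y) * (L + y) * (S + 2*y)) = X * (S + y)"
    using mult by (simp add: KLSP X_def algebra_simps)
  moreover have "(K + y) * (L + y) * (S + 2*y) =
      (S*(K*L+P) + 2*P*(K+L-S)) + (2*K*L + 2*P - S*(K+L-S)) * y"
  proof -
    have "(K + y) * (L + y) * (S + 2*y) = S*K*L + (2*K*L + S*(K+L)) * y + (S + 2*(K+L)) * y^2 + 2 * (y * y^2)"
      by (simp add: algebra_simps power2_eq_square)
    also have "y * y^2 = P * y - S * y^2"
      using arg_cong[OF root', of "\<lambda>u. y * u"] by (simp add: power2_eq_square algebra_simps)
    also have "S*K*L + (2*K*L + S*(K+L)) * y + (S + 2*(K+L)) * y^2 + 2 * (P * y - S * y^2) =
       (S*(K*L+P) + 2*P*(K+L-S)) + (2*K*L + 2*P - S*(K+L-S)) * y"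
      unfolding root' by (simp add: algebra_simps)
    finally show ?thesis .
  qed
  ultimately have "real_of_int n * ((S*(K*L+P) + 2*P*(K+L-S)) + (2*K*L + 2*P - S*(K+L-S)) * y) = X * (S + y)"
    by (simp only:)
  then have lin: "real_of_int A + B * y = 0"
    by (simp add: A_def B_def algebra_simps)
  show False
  proof (cases "B = 0")
    case True
    then have A0: "A = 0" using lin by simp
    have X: "X = n * (2*K*L + 2*P - S*(K+L-S))" using True by (simp add: B_def)
    have "k2 * c2 > 0" "k3 * c2 > 0" using a b b2 by (simp_all add: k2 k3)
    then have "k2 > 0" "k3 > 0" using c2 by (simp_all add: zero_less_mult_iff)
    moreover have "a * b > 0" using a b by simp
    ultimately have "X > 0" unfolding X_def using a b by (intro mult_pos_pos) linarith+
    then have "n \<noteq> 0" using X by auto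
    \<comment> \<open>Substituting \<open>X\<close> from \<open>B = 0\<close> into
      \<open>A = 0\<close> and cancelling \<open>n\<close> leaves a relation between
      \<open>K\<close>, \<open>L\<close>, \<open>S\<close> and \<open>P\<close>.\<close>
    moreover have "n * (S*(K*L+P) + 2*P*(K+L-S)) = n * (2*K*L + 2*P - S*(K+L-S)) * S"
      using A0 X by (simp add: A_def)
    ultimately have "S*(K*L+P) + 2*P*(K+L-S) = (2*K*L + 2*P - S*(K+L-S)) * S" by simp
    then have id: "(K + L) * (S^2 + 2*P) = S * (S^2 + 3*P + K*L)"
      by (simp add: algebra_simps power2_eq_square)
    \<comment> \<open>The Krein bound gives \<open>c2 * y \<le> (b^2 - b - y) * b2\<close>, and the
      factor \<open>b^2 - b - y\<close> is below 2.\<close>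
    have "c2 * real_of_int (b^2 - b - 2) < c2 * y" using ylow c2 by (intro mult_strict_left_mono) auto
    also have "\<dots> \<le> (b^2 - b - y) * b2" using krein by (simp add: algebra_simps)
    also have "\<dots> < real_of_int (2 * b2)"
      using mult_strict_right_mono[of "b^2 - b - y" 2 "real_of_int b2"] ylow b2 by simp
    finally have "real_of_int (c2 * (b^2 - b - 2)) < real_of_int (2 * b2)" by simp
    then have h1: "c2 * (b^2 - b - 2) < 2 * b2" by (simp only: of_int_less_iff)
    have h2: "(b^2 - b - 2)^2 < P" if "S \<ge> 1"
    proof -
      have "real_of_int ((b^2 - b - 2)^2) < y^2" unfolding of_int_power
        by (rule power_strict_mono[OF ylow]) (use bb in \<open>simp_all only: of_int_0_le_iff\<close>)
      also have "\<dots> < P" using root' that ypos by simp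
      finally show ?thesis by (simp only: of_int_less_iff)
    qed
    show False by (rule no_parameters_conjugate_root[OF b a b2 c2 KLSP(2,1,3,4) h1 h2 id])
  next
    case False
    then have "y = - real_of_int A / real_of_int B" using lin by (simp add: field_simps)
    then have "y \<in> \<rat>" by simp
    moreover have "algebraic_int y"
    proof (rule algebraic_int.intros[of "[:- of_int P, of_int S, 1:]"])
      show "poly [:- of_int P, of_int S, 1:] y = 0" using root' by (simp add: power2_eq_square algebra_simps)
    qed (auto simp: coeff_pCons split: nat.splits)
    ultimately have "y \<in> \<int>" by (rule rational_algebraic_int_is_int[rotated])
    then obtain z where z: "y = of_int z" by (elim Ints_cases)
    show False
    proof (rule no_parameters_integral_root[OF b a b2 c2 _ _ _ claw k2 k3])
      show "z > b^2 - b - 2" using ylow unfolding z by linarith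
      have "real_of_int (z^2 + (a + b - b2 - c2) * z) = real_of_int ((b - 1) * c2)"
        using root unfolding z by simp
      then show "z^2 + (a + b - b2 - c2) * z = (b - 1) * c2" by (simp only: of_int_eq_iff)
      have "real_of_int (z * (b2 + c2)) \<le> real_of_int ((b^2 - b) * b2)"
        using krein unfolding z by simp
      then show "z * (b2 + c2) \<le> (b^2 - b) * b2" by (simp only: of_int_le_iff)
      have "real_of_int (n * ((a*b + b + z) * (a + b + z) * (a + b - b2 - c2 + 2*z)))
        = real_of_int ((1 + a*b + k2 + k3) * (a * b * (a + 1) * (a + b - b2 - c2 + z)))"
        using mult unfolding z by simp
      then show "n * ((a*b + b + z) * (a + b + z) * (a + b - b2 - c2 + 2*z))
        = (1 + a*b + k2 + k3) * (a * b * (a + 1) * (a + b - b2 - c2 + z))"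
        by (simp only: of_int_eq_iff)
    qed
  qed
qed

section \<open>Distance-regular graphs of diameter three\<close>

lemma walk_trans: "walk V E n y z \<Longrightarrow> walk V E m x y \<Longrightarrow> walk V E (m + n) x z"
proof (induction rule: walk.induct)
  case (walk0 y) then show ?case by simp
next
  case (walkS n y w z)
  show ?case unfolding add_Suc_right by (rule walk.walkS[OF walkS.IH[OF walkS.prems] walkS.hyps(2,3)])
qed

lemma walk_0_iff: "walk V E 0 x y \<longleftrightarrow> x = y \<and> x \<in> V"
  by (subst walk.simps) auto

lemma walk_Suc_iff: "walk V E (Suc n) x z \<longleftrightarrow> (\<exists>y. walk V E n x y \<and> E y z \<and> z \<in> V)"
  by (subst walk.simps) auto

locale drg3 =
  fixes V :: "'a set" and E :: "'a \<Rightarrow> 'a \<Rightarrow> bool" and b c :: "nat \<Rightarrow> nat"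
  assumes dr: "distance_regular V E 3 b c"
begin

abbreviation d :: "'a \<Rightarrow> 'a \<Rightarrow> nat" where "d \<equiv> gdist V E"

definition N :: "'a \<Rightarrow> 'a set" where "N y = {z \<in> V. E y z}"

definition a :: "nat \<Rightarrow> real" where "a i = real_of_int (isect_a b c i)"

lemma finV: "finite V" and Vne: "V \<noteq> {}" and E_sym: "E x y \<Longrightarrow> E y x" and E_irr: "\<not> E x x"
  and E_V: "E x y \<Longrightarrow> x \<in> V" "E x y \<Longrightarrow> y \<in> V"
  and conn: "x \<in> V \<Longrightarrow> y \<in> V \<Longrightarrow> \<exists>n. walk V E n x y"
  and diam: "diameter V E = 3"
  using dr unfolding distance_regular_def simple_graph_def connected_graph_def by blast+

lemma card_c: "x \<in> V \<Longrightarrow> y \<in> V \<Longrightarrow> d x y \<le> 3 \<Longrightarrow> card {z\<in>V. E y z \<and> d x z = d x y - 1} = c (d x y)"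
  and card_b: "x \<in> V \<Longrightarrow> y \<in> V \<Longrightarrow> d x y \<le> 3 \<Longrightarrow> card {z\<in>V. E y z \<and> d x z = d x y + 1} = b (d x y)"
  using dr unfolding distance_regular_def by blast+

lemma d_walk: "x \<in> V \<Longrightarrow> y \<in> V \<Longrightarrow> walk V E (d x y) x y"
  unfolding gdist_def by (rule LeastI_ex[OF conn])

lemma d_le: "walk V E n x y \<Longrightarrow> d x y \<le> n"
  unfolding gdist_def by (rule Least_le)

lemma walk_edge: "E x y \<Longrightarrow> walk V E (Suc 0) x y"
  using E_V by (auto simp: walk_Suc_iff walk_0_iff)

lemma walk_rev: "walk V E n x y \<Longrightarrow> walk V E n y x"
proof (induction rule: walk.induct)
  case (walk0 x) then show ?case by (rule walk.walk0)
next
  case (walkS n x y z)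
  show ?case using walk_trans[OF walkS.IH walk_edge[OF E_sym[OF walkS.hyps(2)]]] by simp
qed

lemma d_sym: "x \<in> V \<Longrightarrow> y \<in> V \<Longrightarrow> d x y = d y x"
  by (rule antisym) (rule d_le[OF walk_rev[OF d_walk]]; assumption)+

lemma d_eq_0: "x \<in> V \<Longrightarrow> y \<in> V \<Longrightarrow> d x y = 0 \<longleftrightarrow> x = y"
proof
  assume "x \<in> V" "y \<in> V" "d x y = 0"
  then show "x = y" using d_walk[of x y] by (simp add: walk_0_iff)
next
  assume "x \<in> V" "x = y"
  then show "d x y = 0" using d_le[OF walk.walk0[of x V E]] by simp
qed

lemma d_refl: "x \<in> V \<Longrightarrow> d x x = 0"
  by (simp add: d_eq_0)

lemma d_step: "x \<in> V \<Longrightarrow> E y z \<Longrightarrow> d x z \<le> d x y + 1"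
  using d_le[OF walk_trans[OF walk_edge d_walk], of y z x] E_V(1)[of y z] by simp

lemma d_eq_1: "x \<in> V \<Longrightarrow> y \<in> V \<Longrightarrow> d x y = Suc 0 \<longleftrightarrow> E x y"
proof
  assume "x \<in> V" "y \<in> V" "d x y = Suc 0"
  then show "E x y" using d_walk[of x y] by (auto simp: walk_0_iff walk_Suc_iff)
next
  assume xy: "x \<in> V" "y \<in> V" "E x y"
  then have "d x y \<le> 1" using d_step[of x x y] by (simp add: d_refl)
  moreover have "d x y \<noteq> 0" using xy d_eq_0[OF xy(1,2)] E_irr[of x] by auto
  ultimately show "d x y = Suc 0" by simp
qed

lemma d_pred:
  assumes x: "x \<in> V" "z \<in> V" and d: "d x z = Suc n"
  obtains y where "E y z" "y \<in> V" "d x y = n"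
proof -
  have "walk V E (Suc n) x z" using d_walk[OF x] d by simp
  then obtain y where y: "walk V E n x y" "E y z" by (auto simp: walk_Suc_iff)
  have "d x y \<le> n" by (rule d_le[OF y(1)])
  moreover have "Suc n \<le> d x y + 1" using d_step[OF x(1) y(2)] d by simp
  ultimately have "d x y = n" by simp
  then show ?thesis using that[OF y(2) E_V(1)[OF y(2)]] by simp
qed

lemma finite_dists: "finite {d x y | x y. x \<in> V \<and> y \<in> V}"
proof -
  have "{d x y | x y. x \<in> V \<and> y \<in> V} = (\<lambda>(x,y). d x y) ` (V \<times> V)" by auto
  then show ?thesis using finV by simp
qed

lemma d_le_3: "x \<in> V \<Longrightarrow> y \<in> V \<Longrightarrow> d x y \<le> 3"
  using Max_ge[OF finite_dists, of "d x y"] diam unfolding diameter_def by auto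

lemma ex_d_3: "\<exists>x\<in>V. \<exists>y\<in>V. d x y = 3"
proof -
  have "Max {d x y | x y. x \<in> V \<and> y \<in> V} \<in> {d x y | x y. x \<in> V \<and> y \<in> V}"
    using Vne by (intro Max_in finite_dists) auto
  then show ?thesis using diam unfolding diameter_def by auto
qed

text \<open>Step back along a shortest walk from a pair at distance 3. Every intersection number
  thus counts something, which yields \<open>c_pos\<close> and \<open>b_pos\<close>.\<close>

lemma ex_d: "i \<le> 3 \<Longrightarrow> \<exists>x\<in>V. \<exists>y\<in>V. d x y = i"
proof (induction rule: inc_induct)
  case base show ?case by (rule ex_d_3)
next
  case (step i)
  then obtain x y where "x \<in> V" "y \<in> V" "d x y = Suc i" by blast
  then show ?case using d_pred by blast
qed

lemma finN: "finite (N y)"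
  using finV by (simp add: N_def)

lemma N_V: "z \<in> N y \<Longrightarrow> z \<in> V"
  by (simp add: N_def)

lemma card_N: "y \<in> V \<Longrightarrow> card (N y) = b 0"
proof -
  assume y: "y \<in> V"
  have "{z\<in>V. E y z \<and> d y z = d y y + 1} = N y"
    using y d_eq_1[OF y] by (auto simp: N_def d_refl)
  then show ?thesis using card_b[OF y y] by (simp add: d_refl[OF y])
qed

lemma c_0: "c 0 = 0"
proof -
  obtain y where y: "y \<in> V" using Vne by blast
  have "{z\<in>V. E y z \<and> d y z = 0} = {}" using d_eq_0[OF y] E_irr by auto
  then have "card {z\<in>V. E y z \<and> d y z = 0} = 0" by (simp only: card.empty)
  then show ?thesis using card_c[OF y y] by (simp add: d_refl[OF y])
qed

lemma b_3: "b 3 = 0"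
proof -
  obtain x y where xy: "x \<in> V" "y \<in> V" "d x y = 3" using ex_d_3 by blast
  have "{z\<in>V. E y z \<and> d x z = 4} = {}" using d_le_3[OF xy(1)] by fastforce
  then have "card {z\<in>V. E y z \<and> d x z = 4} = 0" by (simp only: card.empty)
  then show ?thesis using card_b[OF xy(1,2)] xy(3) by simp
qed

lemma c_pos: "1 \<le> i \<Longrightarrow> i \<le> 3 \<Longrightarrow> c i > 0"
proof -
  assume i: "1 \<le> i" "i \<le> 3"
  obtain x y where xy: "x \<in> V" "y \<in> V" "d x y = i" using ex_d[OF i(2)] by blast
  obtain z where "E z y" "z \<in> V" "d x z = i - 1" using d_pred[OF xy(1,2), of "i - 1"] xy(3) i by auto
  then have "{z\<in>V. E y z \<and> d x z = i - 1} \<noteq> {}" using E_sym[of z y] by blast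
  then have "card {z\<in>V. E y z \<and> d x z = i - 1} > 0" using finV by (simp add: card_gt_0_iff)
  then show ?thesis using card_c[OF xy(1,2)] xy(3) i by simp
qed

lemma b_pos: "i < 3 \<Longrightarrow> b i > 0"
proof -
  assume i: "i < 3"
  obtain x z where xz: "x \<in> V" "z \<in> V" "d x z = Suc i" using ex_d[of "Suc i"] i by auto
  obtain y where y: "E y z" "y \<in> V" "d x y = i" using d_pred[OF xz] by blast
  then have "{z\<in>V. E y z \<and> d x z = i + 1} \<noteq> {}" using xz by auto
  then have "card {z\<in>V. E y z \<and> d x z = i + 1} > 0" using finV by (simp add: card_gt_0_iff)
  then show ?thesis using card_b[OF xz(1) y(2)] y(3) i by simp
qed

lemma c_1: "c 1 = 1"
proof -
  obtain x y where xy: "x \<in> V" "y \<in> V" "d x y = 1" using ex_d[of 1] by auto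
  have "{z\<in>V. E y z \<and> d x z = 0} = {x}"
    using xy d_eq_0[OF xy(1)] d_eq_1[OF xy(1,2)] E_sym[of x y] by auto
  then show ?thesis using card_c[OF xy(1,2)] xy(3) by simp
qed

text \<open>The action of the intersection matrix; the junk value \<open>u (0 - 1) = u 0\<close> is harmless because
  \<open>c 0 = 0\<close>.\<close>

definition Lop :: "(nat \<Rightarrow> real) \<Rightarrow> nat \<Rightarrow> real" where
  "Lop u i = real (c i) * u (i - 1) + a i * u i + real (b i) * u (i + 1)"

text \<open>Passing to a neighbour of \<open>y\<close> changes the distance from \<open>x\<close> by
  at most one, so \<open>N y\<close> splits into three shells of sizes \<open>c i\<close>,
  \<open>a i\<close>, \<open>b i\<close>. Adjacency therefore acts on functions of the distance
  through \<open>Lop\<close>.\<close>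

lemma sum_neighbours:
  assumes x: "x \<in> V" and y: "y \<in> V" and i: "d x y = i"
  shows "(\<Sum>z\<in>N y. u (d x z)) = Lop u i"
proof -
  have i3: "i \<le> 3" using d_le_3[OF x y] i by simp
  \<comment> \<open>The condition \<open>i \<noteq> 0\<close> keeps \<open>A\<close> disjoint from
    \<open>B\<close>, because \<open>0 - 1 = 0\<close> in the natural numbers.\<close>
  define A where "A = {z \<in> N y. d x z = i - 1 \<and> i \<noteq> 0}"
  define B where "B = {z \<in> N y. d x z = i}"
  define C where "C = {z \<in> N y. d x z = i + 1}"
  have un: "N y = A \<union> B \<union> C"
  proof -
    have "d x z \<in> {i - 1, i, i + 1}" if "z \<in> N y" for z
      using that d_step[OF x, of y z] d_step[OF x, of z y] E_sym[of y z] i by (auto simp: N_def)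
    then show ?thesis unfolding A_def B_def C_def by (cases "i = 0") auto
  qed
  have fin: "finite A" "finite B" "finite C" using finN by (auto simp: A_def B_def C_def)
  have disj: "A \<inter> B = {}" "(A \<union> B) \<inter> C = {}" by (auto simp: A_def B_def C_def)
  have cA: "card A = c i"
  proof (cases "i = 0")
    case True then show ?thesis by (simp add: A_def c_0)
  next
    case False
    then have "A = {z\<in>V. E y z \<and> d x z = d x y - 1}" using i by (auto simp: A_def N_def)
    then show ?thesis using card_c[OF x y] i i3 by simp
  qed
  have "C = {z\<in>V. E y z \<and> d x z = d x y + 1}" using i by (auto simp: C_def N_def)
  then have cC: "card C = b i" using card_b[OF x y] i i3 by simp
  have "card (N y) = card A + card B + card C"
    unfolding un using fin disj by (simp add: card_Un_disjoint)
  then have "real (card B) = a i"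
    using cA cC card_N[OF y] by (simp add: a_def isect_a_def)
  moreover have "(\<Sum>z\<in>N y. u (d x z)) = (\<Sum>z\<in>A. u (d x z)) + (\<Sum>z\<in>B. u (d x z)) + (\<Sum>z\<in>C. u (d x z))"
    unfolding un using fin disj by (simp add: sum.union_disjoint)
  moreover have "(\<Sum>z\<in>A. u (d x z)) = real (card A) * u (i - 1)"
    "(\<Sum>z\<in>B. u (d x z)) = real (card B) * u i" "(\<Sum>z\<in>C. u (d x z)) = real (card C) * u (i + 1)"
    by (simp_all add: A_def B_def C_def)
  ultimately show ?thesis using cA cC by (simp add: Lop_def)
qed

end

section \<open>Truncated inclusion-exclusion and Schur products\<close>

text \<open>Each new set meets the union of the earlier ones in at most \<open>card C * t\<close>
  points. The additive form avoids natural subtraction.\<close>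

lemma card_UN_bonferroni:
  assumes "finite C" "\<And>y. y \<in> C \<Longrightarrow> finite (B y)" "\<And>y. y \<in> C \<Longrightarrow> card (B y) = s"
    and "\<And>y y'. y \<in> C \<Longrightarrow> y' \<in> C \<Longrightarrow> y \<noteq> y' \<Longrightarrow> card (B y \<inter> B y') \<le> t"
  shows "card C * s \<le> card (\<Union>y\<in>C. B y) + (card C choose 2) * t"
  using assms
proof (induction C rule: finite_induct)
  case empty then show ?case by simp
next
  case (insert y C)
  let ?U = "\<Union>z\<in>C. B z"
  have IH: "card C * s \<le> card ?U + (card C choose 2) * t"
    by (rule insert.IH) (use insert.prems in auto)
  have fin: "finite ?U" "finite (B y)" using insert.hyps insert.prems(1) by auto
  have "card (?U \<inter> B y) = card (\<Union>z\<in>C. B z \<inter> B y)" by (rule arg_cong[of _ _ card]) auto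
  also have "\<dots> \<le> (\<Sum>z\<in>C. card (B z \<inter> B y))" by (rule card_UN_le[OF insert.hyps(1)])
  also have "\<dots> \<le> (\<Sum>z\<in>C. t)"
    using insert.hyps(2) by (intro sum_mono insert.prems(3)) auto
  finally have "card (?U \<inter> B y) \<le> card C * t" by simp
  moreover have "card ?U + card (B y) = card (?U \<union> B y) + card (?U \<inter> B y)"
    by (rule card_Un_Int[OF fin])
  moreover have "card (B y) = s" using insert.prems(2) by simp
  moreover have "(\<Union>z\<in>insert y C. B z) = ?U \<union> B y" by auto
  moreover have "card (insert y C) = Suc (card C)" using insert.hyps by simp
  moreover have "Suc (card C) choose 2 = (card C choose 2) + card C"
    by (simp add: numeral_2_eq_2)
  ultimately show ?case using IH by (simp add: algebra_simps)
qed

text \<open>Schur product theorem with a Gram kernel as one factor: the form splits over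
  \<open>z\<close> into values of the form of \<open>K\<close> at the functions
  \<open>f x * U x z\<close> of \<open>x\<close>.\<close>

lemma schur_product_gram:
  fixes K U :: "'a \<Rightarrow> 'a \<Rightarrow> real"
  assumes psd: "\<And>f. (\<Sum>x\<in>V. \<Sum>y\<in>V. f x * f y * K x y) \<ge> 0"
  shows "(\<Sum>x\<in>V. \<Sum>y\<in>V. f x * f y * (K x y * (\<Sum>z\<in>V. U x z * U y z))) \<ge> 0"
proof -
  have "(\<Sum>x\<in>V. \<Sum>y\<in>V. f x * f y * (K x y * (\<Sum>z\<in>V. U x z * U y z)))
     = (\<Sum>x\<in>V. \<Sum>y\<in>V. \<Sum>z\<in>V. (f x * U x z) * (f y * U y z) * K x y)"
    by (simp add: sum_distrib_left mult_ac)
  also have "\<dots> = (\<Sum>x\<in>V. \<Sum>z\<in>V. \<Sum>y\<in>V. (f x * U x z) * (f y * U y z) * K x y)"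
    by (intro sum.cong[OF refl] sum.swap)
  also have "\<dots> = (\<Sum>z\<in>V. \<Sum>x\<in>V. \<Sum>y\<in>V. (f x * U x z) * (f y * U y z) * K x y)"
    by (rule sum.swap)
  also have "\<dots> \<ge> 0" by (intro sum_nonneg psd)
  finally show ?thesis .
qed

context drg3
begin

section \<open>Eigenfunctions and the intersection matrix\<close>

definition eigfun :: "real \<Rightarrow> ('a \<Rightarrow> real) \<Rightarrow> bool" where
  "eigfun \<theta> f \<longleftrightarrow> (\<forall>y\<in>V. (\<Sum>z\<in>N y. f z) = \<theta> * f y)"

text \<open>Right eigenvectors of the intersection matrix; with \<open>u 0 = 1\<close> these are the
  standard (cosine) sequences.\<close>

definition eigseq :: "real \<Rightarrow> (nat \<Rightarrow> real) \<Rightarrow> bool" where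
  "eigseq \<theta> u \<longleftrightarrow> (\<forall>i\<le>3. Lop u i = \<theta> * u i)"

lemma eigfun_of_eigseq: "eigseq \<theta> u \<Longrightarrow> x \<in> V \<Longrightarrow> eigfun \<theta> (\<lambda>z. u (d x z))"
  unfolding eigfun_def eigseq_def by (simp add: sum_neighbours d_le_3)

text \<open>Interchanging the double sum over adjacent pairs moves the adjacency operator from
  \<open>v\<close> to \<open>f\<close>, where it acts as \<open>\<theta>\<close>.\<close>

lemma adjoint:
  assumes f: "eigfun \<theta> f" and x: "x \<in> V"
  shows "(\<Sum>y\<in>V. f y * (Lop v (d x y) - \<theta> * v (d x y))) = 0"
proof -
  have "(\<Sum>y\<in>V. f y * Lop v (d x y)) = (\<Sum>y\<in>V. \<Sum>z\<in>{z\<in>V. E y z}. f y * v (d x z))"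
    using x by (intro sum.cong) (auto simp: sum_neighbours[symmetric] N_def sum_distrib_left)
  also have "\<dots> = (\<Sum>z\<in>V. \<Sum>y\<in>{y\<in>V. E y z}. f y * v (d x z))"
    by (rule sum.swap_restrict[OF finV finV])
  also have "\<dots> = (\<Sum>z\<in>V. \<theta> * f z * v (d x z))"
  proof (rule sum.cong[OF refl])
    fix z assume z: "z \<in> V"
    have "{y\<in>V. E y z} = N z" unfolding N_def using E_sym by blast
    then show "(\<Sum>y\<in>{y\<in>V. E y z}. f y * v (d x z)) = \<theta> * f z * v (d x z)"
      using f z by (simp add: eigfun_def sum_distrib_right[symmetric])
  qed
  finally show ?thesis by (simp add: algebra_simps sum_subtractf)
qed

text \<open>The rows 1, 2, 3 of the intersection matrix determine a sequence from its last entry,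
  so the image of \<open>L - \<theta>\<close> together with the indicator of \<open>0\<close> spans all sequences.\<close>

lemma solve_backward:
  obtains w where "w 3 = t" "\<And>i. 1 \<le> i \<Longrightarrow> i \<le> 3 \<Longrightarrow> Lop w i - \<theta> * w i = v i"
proof -
  define w2 where "w2 = (v 3 - (a 3 - \<theta>) * t) / c 3"
  define w1 where "w1 = (v 2 - (a 2 - \<theta>) * w2 - b 2 * t) / c 2"
  define w0 where "w0 = v 1 - (a 1 - \<theta>) * w1 - b 1 * w2"
  define w where "w i = (if i = 0 then w0 else if i = 1 then w1 else if i = 2 then w2 else t)" for i :: nat
  have c: "c 3 > 0" "c 2 > 0" "c 1 = 1" using c_pos[of 3] c_pos[of 2] c_1 by auto
  have "Lop w i - \<theta> * w i = v i" if "1 \<le> i" "i \<le> 3" for i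
  proof -
    from that have "i \<in> {1,2,3}" by auto
    then show ?thesis
    proof (elim insertE emptyE)
      assume "i = 3" then show ?thesis using c b_3
        by (simp add: Lop_def w_def w2_def field_simps)
    next
      assume "i = 2" then show ?thesis using c
        by (simp add: Lop_def w_def w1_def field_simps)
    next
      assume "i = 1" then show ?thesis using c
        by (simp add: Lop_def w_def w0_def field_simps numeral_2_eq_2[symmetric])
    qed
  qed
  moreover have "w 3 = t" by (simp add: w_def)
  ultimately show ?thesis using that by blast
qed

lemma sum_dist_zero:
  fixes f :: "'a \<Rightarrow> real"
  assumes x: "x \<in> V" and h: "\<And>i. 1 \<le> i \<Longrightarrow> i \<le> 3 \<Longrightarrow> h i = 0"
  shows "(\<Sum>y\<in>V. f y * h (d x y)) = f x * h 0"
proof -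
  have "(\<Sum>y\<in>V. f y * h (d x y)) = (\<Sum>y\<in>V. if y = x then f x * h 0 else 0)"
  proof (rule sum.cong[OF refl])
    fix y assume y: "y \<in> V"
    show "f y * h (d x y) = (if y = x then f x * h 0 else 0)"
    proof (cases "y = x")
      case True then show ?thesis using x by (simp add: d_refl)
    next
      case False
      then have "1 \<le> d x y" using d_eq_0[OF x y] by auto
      then show ?thesis using h d_le_3[OF x y] False by simp
    qed
  qed
  then show ?thesis using x finV by simp
qed

text \<open>An eigenfunction with \<open>f x \<noteq> 0\<close>, tested against a sequence solving
  rows 1, 2, 3, forces row 0. Conversely \<open>u (d x z)\<close> is an eigenfunction of
  \<open>z\<close>, nonzero at distance 3. The normalisation sits at index 3 because the rows are
  solved from there.\<close>

lemma adj_eigenvalue_iff: "adj_eigenvalue V E \<theta> \<longleftrightarrow> (\<exists>u. eigseq \<theta> u \<and> u 3 = 1)"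
proof
  assume "adj_eigenvalue V E \<theta>"
  then obtain f x where f: "eigfun \<theta> f" and x: "x \<in> V" "f x \<noteq> 0"
    unfolding adj_eigenvalue_def eigfun_def N_def by blast
  obtain w where w: "w 3 = 1" "\<And>i. 1 \<le> i \<Longrightarrow> i \<le> 3 \<Longrightarrow> Lop w i - \<theta> * w i = 0"
    using solve_backward[where v = "\<lambda>_. 0"] by metis
  have "f x * (Lop w 0 - \<theta> * w 0) = 0"
    using adjoint[OF f x(1), of w] sum_dist_zero[OF x(1), of "\<lambda>i. Lop w i - \<theta> * w i" f] w(2) by simp
  then have "Lop w 0 - \<theta> * w 0 = 0" using x(2) by simp
  then have "Lop w i = \<theta> * w i" if "i \<le> 3" for i
    using w(2)[of i] that by (cases "i = 0") auto
  then show "\<exists>u. eigseq \<theta> u \<and> u 3 = 1" using w(1) unfolding eigseq_def by blast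
next
  assume "\<exists>u. eigseq \<theta> u \<and> u 3 = 1"
  then obtain u where u: "eigseq \<theta> u" "u 3 = 1" by blast
  obtain x y where xy: "x \<in> V" "y \<in> V" "d x y = 3" using ex_d_3 by blast
  have "eigfun \<theta> (\<lambda>z. u (d x z))" by (rule eigfun_of_eigseq[OF u(1) xy(1)])
  moreover have "u (d x y) \<noteq> 0" using u(2) xy(3) by simp
  ultimately show "adj_eigenvalue V E \<theta>"
    unfolding adj_eigenvalue_def eigfun_def N_def
    by (intro exI[of _ "\<lambda>z. u (d x z)"] conjI bexI[OF _ xy(2)])
qed

text \<open>Write \<open>v\<close> as an element of the image of \<open>L - \<theta>\<close> plus a
  multiple of the indicator of 0. The first part is orthogonal to every eigenfunction, so both sums
  are governed by the same number \<open>h 0\<close>.\<close>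

lemma mean_value:
  assumes f: "eigfun \<theta> f" and u: "eigseq \<theta> u" "u 0 = 1" and x: "x \<in> V"
  shows "(\<Sum>z\<in>V. f z * v (d x z)) = f x * (\<Sum>z\<in>V. u (d x z) * v (d x z))"
proof -
  obtain w where w: "\<And>i. 1 \<le> i \<Longrightarrow> i \<le> 3 \<Longrightarrow> Lop w i - \<theta> * w i = v i"
    using solve_backward[where v = v] by metis
  define h where "h i = v i - (Lop w i - \<theta> * w i)" for i
  have *: "(\<Sum>z\<in>V. g z * v (d x z)) = g x * h 0" if g: "eigfun \<theta> g" for g
  proof -
    have "(\<Sum>z\<in>V. g z * v (d x z)) = (\<Sum>z\<in>V. g z * h (d x z))
        + (\<Sum>z\<in>V. g z * (Lop w (d x z) - \<theta> * w (d x z)))"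
      by (simp add: h_def sum.distrib[symmetric] algebra_simps)
    also have "\<dots> = g x * h 0"
      using adjoint[OF g x, of w] sum_dist_zero[OF x, of h g] w by (simp add: h_def)
    finally show ?thesis .
  qed
  show ?thesis using *[OF f] *[OF eigfun_of_eigseq[OF u(1) x]] u(2) by (simp add: d_refl[OF x])
qed

section \<open>Sphere sizes, multiplicities and Krein conditions\<close>

definition sphere_size :: "nat \<Rightarrow> real" where
  "sphere_size i = (\<Prod>j<i. b j / c (Suc j))"

text \<open>The intersection matrix has constant row sums \<open>b 0\<close>, so only the two
  indices at the boundary of the ball survive.\<close>

lemma Lop_indicator:
  "Lop (\<lambda>j. if j \<le> i then 1 else 0) j - real (b 0) * (if j \<le> i then 1 else 0) =
    (if j = i then - real (b i) else if j = Suc i then real (c j) else 0)"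
proof -
  have "c j + a j + b j = b 0" by (simp add: a_def isect_a_def)
  then show ?thesis using c_0 by (auto simp: Lop_def le_Suc_eq Suc_le_eq not_le)
qed

text \<open>Pairing the constant eigenfunction with the ball indicator counts the edges between
  consecutive spheres from both sides, giving the recursion that \<open>sphere_size\<close>
  solves.\<close>

lemma card_sphere:
  assumes x: "x \<in> V"
  shows "i \<le> 3 \<Longrightarrow> card {z\<in>V. d x z = i} = sphere_size i"
proof (induction i)
  case 0
  have "{z\<in>V. d x z = 0} = {x}" using d_eq_0[OF x] x by auto
  then show ?case by (simp add: sphere_size_def)
next
  case (Suc i)
  let ?v = "\<lambda>j. if j \<le> i then 1 else 0 :: real"
  have one: "eigfun (b 0) (\<lambda>_. 1)" by (simp add: eigfun_def card_N)
  have "0 = (\<Sum>y\<in>V. 1 * (Lop ?v (d x y) - b 0 * ?v (d x y)))"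
    by (rule adjoint[OF one x, symmetric])
  also have "\<dots> = (\<Sum>y\<in>V. (if d x y = i then - real (b i) else 0) + (if d x y = Suc i then real (c (Suc i)) else 0))"
    unfolding Lop_indicator by (intro sum.cong) auto
  also have "\<dots> = - real (b i) * card {z\<in>V. d x z = i} + real (c (Suc i)) * card {z\<in>V. d x z = Suc i}"
    using finV by (simp add: sum.distrib sum.inter_filter[symmetric])
  finally show ?case using Suc c_pos[of "Suc i"] by (simp add: sphere_size_def field_simps)
qed

lemma sum_spheres:
  assumes x: "x \<in> V"
  shows "(\<Sum>z\<in>V. h (d x z)) = (\<Sum>i\<le>3. sphere_size i * h i)"
proof -
  have "(\<Sum>z\<in>V. h (d x z)) = (\<Sum>i\<le>3. \<Sum>z\<in>{z\<in>V. d x z = i}. h (d x z))"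
    using d_le_3[OF x] finV by (intro sum.group[symmetric]) auto
  also have "\<dots> = (\<Sum>i\<le>3. card {z\<in>V. d x z = i} * h i)" by (intro sum.cong) auto
  also have "\<dots> = (\<Sum>i\<le>3. sphere_size i * h i)" by (intro sum.cong) (auto simp: card_sphere[OF x])
  finally show ?thesis .
qed

text \<open>The squared norm on \<open>V\<close> of the function \<open>u (d x z)\<close> of
  \<open>z\<close>, the same for every centre \<open>x\<close>.\<close>

definition wnorm :: "(nat \<Rightarrow> real) \<Rightarrow> real" where
  "wnorm u = (\<Sum>i\<le>3. sphere_size i * (u i)\<^sup>2)"

lemma sphere_size_nonneg: "sphere_size i \<ge> 0"
  unfolding sphere_size_def by (intro prod_nonneg) simp

lemma wnorm_pos: "u 0 = 1 \<Longrightarrow> wnorm u > 0"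
proof -
  assume "u 0 = 1"
  then have "(1::real) = (\<Sum>i\<in>{0::nat}. sphere_size i * (u i)\<^sup>2)" by (simp add: sphere_size_def)
  also have "\<dots> \<le> wnorm u" unfolding wnorm_def
    by (rule sum_mono2) (auto simp: sphere_size_nonneg)
  finally show ?thesis by simp
qed

text \<open>\<open>mean_value\<close> about \<open>y\<close>, applied to the eigenfunction centred
  at \<open>x\<close>: the kernel \<open>u (d x y)\<close> is idempotent up to the factor
  \<open>wnorm u\<close>.\<close>

lemma gram_eigseq:
  assumes u: "eigseq \<theta> u" "u 0 = 1" and x: "x \<in> V" and y: "y \<in> V"
  shows "(\<Sum>z\<in>V. u (d x z) * u (d y z)) = wnorm u * u (d x y)"
proof -
  have "(\<Sum>z\<in>V. u (d x z) * u (d y z)) = u (d x y) * (\<Sum>z\<in>V. u (d y z) * u (d y z))"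
    by (rule mean_value[OF eigfun_of_eigseq[OF u(1) x] u y])
  also have "(\<Sum>z\<in>V. u (d y z) * u (d y z)) = wnorm u"
    using sum_spheres[OF y, of "\<lambda>i. u i * u i"] by (simp add: wnorm_def power2_eq_square)
  finally show ?thesis by simp
qed

text \<open>The kernel \<open>u (d x y) / wnorm u\<close> is the projection onto the eigenspace; its
  trace, the multiplicity of \<open>\<theta>\<close>, equals
  \<open>card V / wnorm u\<close>.\<close>

lemma multiplicity_nat:
  assumes u: "eigseq \<theta> u" "u 0 = 1"
  shows "\<exists>m::nat. m * wnorm u = (\<Sum>i\<le>3. sphere_size i)"
proof -
  define P where "P x y = u (d x y) / wnorm u" for x y
  have pos: "wnorm u > 0" using wnorm_pos u by simp
  have "(\<Sum>z\<in>V. P x z * P z y) = P x y" if xy: "x \<in> V" "y \<in> V" for x y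
  proof -
    have "(\<Sum>z\<in>V. P x z * P z y) = (\<Sum>z\<in>V. u (d x z) * u (d y z)) / (wnorm u)\<^sup>2"
      unfolding P_def sum_divide_distrib
      by (intro sum.cong) (simp_all add: d_sym[OF _ xy(2)] power2_eq_square)
    then show ?thesis using gram_eigseq[OF u xy] pos by (simp add: P_def power2_eq_square)
  qed
  from idempotent_kernel_trace_nat[OF finV this] obtain m :: nat where m: "(\<Sum>x\<in>V. P x x) = m" by blast
  have "(\<Sum>x\<in>V. P x x) = (\<Sum>x\<in>V. 1 / wnorm u)"
    by (intro sum.cong) (auto simp: P_def d_refl u(2))
  then have "m * wnorm u = card V" using m pos by (simp add: field_simps)
  moreover obtain x where "x \<in> V" using Vne by blast
  then have "real (card V) = (\<Sum>i\<le>3. sphere_size i)" using sum_spheres[of x "\<lambda>_. 1"] by simp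
  ultimately show ?thesis by auto
qed

text \<open>The three kernels are positive multiples of Gram kernels, so their entrywise product is
  positive semidefinite; it is evaluated at the all-ones function.\<close>

lemma krein_nonneg:
  assumes u: "eigseq \<theta> u" "u 0 = 1" and v: "eigseq \<eta> v" "v 0 = 1" and w: "eigseq \<zeta> w" "w 0 = 1"
  shows "(\<Sum>i\<le>3. sphere_size i * (u i * v i * w i)) \<ge> 0"
proof -
  define G where "G u x y = (\<Sum>z\<in>V. u (d x z) * u (d y z))" for u :: "nat \<Rightarrow> real" and x y
  \<comment> \<open>The constant kernel, whose form is a square, is the start; the Gram kernels are
    multiplied in one at a time.\<close>
  have "(\<Sum>x\<in>V. \<Sum>y\<in>V. f x * f y * 1) \<ge> 0" for f :: "'a \<Rightarrow> real"
    using zero_le_square[of "sum f V"] by (simp add: sum_product)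
  from schur_product_gram[OF schur_product_gram[OF schur_product_gram[OF this]],
      of "\<lambda>_. 1" "\<lambda>x z. u (d x z)" "\<lambda>x z. v (d x z)" "\<lambda>x z. w (d x z)"]
  have "0 \<le> (\<Sum>x\<in>V. \<Sum>y\<in>V. G u x y * G v x y * G w x y)"
    by (simp add: G_def)
  also have "\<dots> = (\<Sum>x\<in>V. \<Sum>y\<in>V. wnorm u * wnorm v * wnorm w * (u (d x y) * v (d x y) * w (d x y)))"
    by (intro sum.cong refl) (simp add: G_def gram_eigseq[OF u] gram_eigseq[OF v] gram_eigseq[OF w])
  also have "\<dots> = (\<Sum>x\<in>V. wnorm u * wnorm v * wnorm w * (\<Sum>i\<le>3. sphere_size i * (u i * v i * w i)))"
    unfolding sum_distrib_left[symmetric]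
    by (intro sum.cong refl arg_cong[where f = "(*) _"] sum_spheres)
  also have "\<dots> = (card V * wnorm u * wnorm v * wnorm w) * (\<Sum>i\<le>3. sphere_size i * (u i * v i * w i))"
    by simp
  finally have le: "0 \<le> (card V * wnorm u * wnorm v * wnorm w) * (\<Sum>i\<le>3. sphere_size i * (u i * v i * w i))" .
  have "real (card V) > 0" using Vne finV by (simp add: card_gt_0_iff)
  then have "card V * wnorm u * wnorm v * wnorm w > 0"
    by (intro mult_pos_pos wnorm_pos u(2) v(2) w(2))
  with le show ?thesis by (meson mult_pos_neg not_less)
qed

section \<open>Cocliques inside a neighbourhood\<close>

lemma card_common_adj:
  assumes x: "x \<in> V" and y: "y \<in> N x"
  shows "real (card (N x \<inter> N y)) = a 1"
proof -
  have yV: "y \<in> V" using y by (rule N_V)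
  have xy: "d x y = 1" using y d_eq_1[OF x yV] by (simp add: N_def)
  have "(\<Sum>z\<in>N y. if d x z = 1 then 1 else 0) = a 1"
    using sum_neighbours[OF x yV xy, of "\<lambda>j. if j = 1 then 1 else 0"] by (simp add: Lop_def)
  moreover have "(\<Sum>z\<in>N y. if d x z = 1 then 1 else 0) = (\<Sum>z\<in>N y. if z \<in> N x then 1 else 0 :: real)"
    by (intro sum.cong refl) (use d_eq_1[OF x] in \<open>auto simp: N_def\<close>)
  moreover have "\<dots> = card (N x \<inter> N y)"
    using finN by (simp add: Int_commute flip: sum.inter_restrict)
  ultimately show ?thesis by simp
qed

text \<open>The closed neighbourhood of \<open>y\<close> in the graph induced on
  \<open>N x\<close>.\<close>

definition B :: "'a \<Rightarrow> 'a \<Rightarrow> 'a set" where "B x y = N x \<inter> insert y (N y)"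

lemma card_B:
  assumes "x \<in> V" "y \<in> N x" "a 1 = real \<alpha>"
  shows "card (B x y) = \<alpha> + 1"
proof -
  have "B x y = insert y (N x \<inter> N y)" using assms(2) by (auto simp: B_def)
  moreover have "y \<notin> N x \<inter> N y" using E_irr by (simp add: N_def)
  ultimately show ?thesis using finN card_common_adj[OF assms(1,2)] assms(3) by simp
qed

text \<open>Greedy choice: the sets \<open>B x y\<close> of \<open>m\<close> chosen vertices cover
  at most \<open>m * (\<alpha> + 1)\<close> points of \<open>N x\<close>, and any uncovered point
  extends the coclique.\<close>

lemma coclique_exists:
  assumes x: "x \<in> V" and \<alpha>: "a 1 = real \<alpha>"
  shows "m = 0 \<or> (m - 1) * (\<alpha> + 1) < b 0 \<Longrightarrow>
    \<exists>C\<subseteq>N x. card C = m \<and> (\<forall>y\<in>C. \<forall>z\<in>C. \<not> E y z)"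
proof (induction m)
  case 0 then show ?case by (intro exI[of _ "{}"]) auto
next
  case (Suc m)
  then have lt: "m * (\<alpha> + 1) < b 0" by simp
  have "m = 0 \<or> (m - 1) * (\<alpha> + 1) < b 0"
    using lt by (cases m) auto
  then obtain C where C: "C \<subseteq> N x" "card C = m" "\<And>y z. y \<in> C \<Longrightarrow> z \<in> C \<Longrightarrow> \<not> E y z"
    using Suc.IH by blast
  have finC: "finite C" by (rule finite_subset[OF C(1) finN])
  have "card (\<Union>y\<in>C. B x y) \<le> (\<Sum>y\<in>C. card (B x y))" by (rule card_UN_le[OF finC])
  also have "\<dots> = (\<Sum>y\<in>C. \<alpha> + 1)"
    by (intro sum.cong refl card_B[OF x _ \<alpha>]) (use C(1) in auto)
  also have "\<dots> < card (N x)" using lt by (simp add: C(2) card_N[OF x])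
  finally have "\<not> N x \<subseteq> (\<Union>y\<in>C. B x y)"
    using card_mono[of "\<Union>y\<in>C. B x y" "N x"] finC finN by (auto simp: B_def)
  then obtain z where z: "z \<in> N x" "\<And>y. y \<in> C \<Longrightarrow> z \<notin> B x y" by blast
  have zC: "\<not> E y z \<and> y \<noteq> z" if "y \<in> C" for y
    using z(1) z(2)[OF that] N_V[OF z(1)] by (auto simp: B_def N_def)
  have "z \<notin> C" using zC by blast
  moreover have "\<not> E y y'" if "y \<in> insert z C" "y' \<in> insert z C" for y y'
    using that zC C(3) E_irr[of z] E_sym[of y y'] by (elim insertE) auto
  ultimately show ?case using C(1,2) finC z(1) by (intro exI[of _ "insert z C"]) auto
qed

text \<open>Two members of a coclique in \<open>N x\<close> are at distance 2, and \<open>x\<close>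
  is one of their \<open>c 2\<close> common neighbours. Their sets \<open>B x y\<close> thus share
  at most \<open>c 2 - 1\<close> vertices, and the Bonferroni inequality applies inside
  \<open>N x\<close>.\<close>

lemma claw_bound:
  assumes \<alpha>: "a 1 = real \<alpha>" and m: "m * (\<alpha> + 1) < b 0"
  shows "Suc m * (\<alpha> + 1) \<le> b 0 + (Suc m choose 2) * (c 2 - 1)"
proof -
  obtain x where x: "x \<in> V" using Vne by blast
  obtain C where C: "C \<subseteq> N x" "card C = Suc m" "\<And>y z. y \<in> C \<Longrightarrow> z \<in> C \<Longrightarrow> \<not> E y z"
    using coclique_exists[OF x \<alpha>, of "Suc m"] m by auto
  have finC: "finite C" by (rule finite_subset[OF C(1) finN])
  have finB: "finite (B x y)" for y using finN by (simp add: B_def)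
  have "card C * (\<alpha> + 1) \<le> card (\<Union>y\<in>C. B x y) + (card C choose 2) * (c 2 - 1)"
  proof (rule card_UN_bonferroni[OF finC finB])
    fix y assume "y \<in> C"
    then show "card (B x y) = \<alpha> + 1" using C(1) by (intro card_B[OF x _ \<alpha>]) auto
  next
    fix y y' assume yC: "y \<in> C" "y' \<in> C" "y \<noteq> y'"
    have xy: "E x y" "E x y'" using yC C(1) by (auto simp: N_def)
    have yV: "y \<in> V" "y' \<in> V" using xy E_V by blast+
    have "d y x = 1" using d_eq_1[OF yV(1) x] E_sym[OF xy(1)] by simp
    then have "d y y' \<le> 2" using d_step[OF yV(1) xy(2)] by simp
    moreover have "d y y' \<noteq> 0" using d_eq_0[OF yV] yC(3) by simp
    moreover have "d y y' \<noteq> Suc 0" using d_eq_1[OF yV] C(3)[OF yC(1,2)] by simp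
    ultimately have d2: "d y y' = 2" by simp
    have "{z\<in>V. E y' z \<and> d y z = 1} = N y \<inter> N y'"
      using d_eq_1[OF yV(1)] by (auto simp: N_def)
    then have c2: "card (N y \<inter> N y') = c 2" using card_c[OF yV] d2 by simp
    \<comment> \<open>Nonadjacency excludes \<open>y\<close> and \<open>y'\<close> themselves, and
      \<open>x\<close> drops out because it is not in \<open>N x\<close>.\<close>
    have "B x y \<inter> B x y' \<subseteq> (N y \<inter> N y') - {x}"
      using yC(3) C(3)[OF yC(1,2)] C(3)[OF yC(2,1)] E_irr[of x] by (auto simp: B_def N_def)
    then have "card (B x y \<inter> B x y') \<le> card ((N y \<inter> N y') - {x})"
      using finN by (intro card_mono) auto
    also have "x \<in> N y \<inter> N y'" using x E_sym[OF xy(1)] E_sym[OF xy(2)] by (simp add: N_def)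
    then have "card ((N y \<inter> N y') - {x}) = c 2 - 1" using c2 by simp
    finally show "card (B x y \<inter> B x y') \<le> c 2 - 1" .
  qed
  moreover have "card (\<Union>y\<in>C. B x y) \<le> card (N x)"
    using finN by (intro card_mono) (auto simp: B_def)
  ultimately show ?thesis using C(2) card_N[OF x] by simp
qed

section \<open>The spectrum in terms of the intersection numbers\<close>

lemma a_nonneg: "1 \<le> i \<Longrightarrow> i \<le> 3 \<Longrightarrow> a i \<ge> 0"
proof -
  assume i: "1 \<le> i" "i \<le> 3"
  obtain x y where xy: "x \<in> V" "y \<in> V" "d x y = i" using ex_d[OF i(2)] by blast
  have "(0::real) \<le> (\<Sum>z\<in>N y. if d x z = i then 1 else 0)" by (intro sum_nonneg) auto
  also have "\<dots> = a i"
    using sum_neighbours[OF xy, of "\<lambda>j. if j = i then 1 else 0"] i by (simp add: Lop_def)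
  finally show ?thesis .
qed

lemma a_eq: "a i = real (b 0) - real (b i) - real (c i)"
  by (simp add: a_def isect_a_def)

lemma Lop_simps:
  fixes u :: "nat \<Rightarrow> real"
  shows
  "Lop u 0 = b 0 * u 1" "Lop u 1 = u 0 + a 1 * u 1 + b 1 * u 2"
  "Lop u 2 = c 2 * u 1 + a 2 * u 2 + b 2 * u 3" "Lop u 3 = c 3 * u 2 + a 3 * u 3"
  using c_0 c_1 b_3 a_eq[of 0] by (simp_all add: Lop_def numeral_2_eq_2[symmetric])

lemma eigseq_iff:
  fixes u :: "nat \<Rightarrow> real" and \<theta> :: real
  shows
  "eigseq \<theta> u \<longleftrightarrow> b 0 * u 1 = \<theta> * u 0 \<and> u 0 + a 1 * u 1 + b 1 * u 2 = \<theta> * u 1 \<and>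
    c 2 * u 1 + a 2 * u 2 + b 2 * u 3 = \<theta> * u 2 \<and> c 3 * u 2 + a 3 * u 3 = \<theta> * u 3"
proof -
  have "(\<forall>i\<le>3. Lop u i = \<theta> * u i) \<longleftrightarrow> (\<forall>i\<in>{0,1,2,3}. Lop u i = \<theta> * u i)"
    by (auto simp: le_Suc_eq numeral_3_eq_3 numeral_2_eq_2)
  then show ?thesis unfolding eigseq_def by (simp add: Lop_simps del: One_nat_def)
qed

text \<open>The characteristic polynomial of the intersection matrix with the factor for the
  eigenvalue \<open>k = b\<^sub>0\<close> removed.\<close>

definition charpoly :: "real poly" where
  "charpoly = [:1, 1:] * ([:real (b 1) + c 2 - b 0, 1:] * [:real (b 2) + c 3 - b 0, 1:] - [:real (b 2) * c 2:])
     - [:real (b 1):] * [:real (b 2) + c 3 - b 0, 1:]"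

lemma poly_charpoly:
  fixes \<theta> :: real
  shows
  "poly charpoly \<theta> = (\<theta> + 1) * ((\<theta> - b 0 + b 1 + c 2) * (\<theta> - b 0 + b 2 + c 3) - real (b 2) * c 2)
     - b 1 * (\<theta> - b 0 + b 2 + c 3)"
  by (simp add: charpoly_def algebra_simps)

text \<open>Rows 1, 2, 3 determine \<open>w\<close>. The defect in row 0, cleared of the
  denominators \<open>c 2\<close> and \<open>c 3\<close>, is the full characteristic polynomial of
  the intersection matrix.\<close>

lemma charpoly_backward:
  fixes w :: "nat \<Rightarrow> real" and \<theta> :: real
  assumes "w 3 = 1" "w 0 + a 1 * w 1 + b 1 * w 2 = \<theta> * w 1"
    "c 2 * w 1 + a 2 * w 2 + b 2 * w 3 = \<theta> * w 2" "c 3 * w 2 + a 3 * w 3 = \<theta> * w 3"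
  shows "real (c 2) * c 3 * (\<theta> * w 0 - b 0 * w 1) = (\<theta> - b 0) * poly charpoly \<theta>"
proof -
  have e2: "c 3 * w 2 = \<theta> - a 3" and e1: "c 2 * w 1 = (\<theta> - a 2) * w 2 - b 2"
    and e0: "w 0 = (\<theta> - a 1) * w 1 - b 1 * w 2" using assms by (simp_all add: algebra_simps)
  have e1': "real (c 2) * c 3 * w 1 = (\<theta> - a 2) * (\<theta> - a 3) - real (b 2) * c 3"
  proof -
    have "real (c 2) * c 3 * w 1 = c 3 * (c 2 * w 1)" by simp
    also have "\<dots> = (\<theta> - a 2) * (c 3 * w 2) - real (b 2) * c 3" unfolding e1 by (simp add: algebra_simps)
    finally show ?thesis unfolding e2 .
  qed
  have "real (c 2) * c 3 * (\<theta> * w 0 - b 0 * w 1)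
      = (\<theta> * (\<theta> - a 1) - b 0) * (real (c 2) * c 3 * w 1) - \<theta> * b 1 * c 2 * (c 3 * w 2)"
    unfolding e0 by (simp add: algebra_simps)
  also have "\<dots> = (\<theta> - b 0) * poly charpoly \<theta>"
    unfolding e1' unfolding e2 poly_charpoly a_eq using c_1 b_3 by (simp add: algebra_simps)
  finally show ?thesis .
qed

lemma adj_spectrum_eq: "adj_spectrum V E = {\<theta>. (\<theta> - b 0) * poly charpoly \<theta> = 0}"
proof -
  have "adj_eigenvalue V E \<theta> \<longleftrightarrow> (\<theta> - b 0) * poly charpoly \<theta> = 0" for \<theta>
  proof
    assume "adj_eigenvalue V E \<theta>"
    then obtain u where u: "eigseq \<theta> u" "u 3 = 1" unfolding adj_eigenvalue_iff by blast
    note e = u(1)[unfolded eigseq_iff]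
    have "real (c 2) * c 3 * (\<theta> * u 0 - b 0 * u 1) = (\<theta> - b 0) * poly charpoly \<theta>"
      by (rule charpoly_backward[where w = u, OF u(2)]) (use e in blast)+
    then show "(\<theta> - b 0) * poly charpoly \<theta> = 0" using e by simp
  next
    assume 0: "(\<theta> - b 0) * poly charpoly \<theta> = 0"
    obtain w where w: "w 3 = 1" "\<And>i. 1 \<le> i \<Longrightarrow> i \<le> 3 \<Longrightarrow> Lop w i - \<theta> * w i = 0"
      using solve_backward[where v = "\<lambda>_. 0"] by metis
    have e: "w 0 + a 1 * w 1 + b 1 * w 2 = \<theta> * w 1" "c 2 * w 1 + a 2 * w 2 + b 2 * w 3 = \<theta> * w 2"
      "c 3 * w 2 + a 3 * w 3 = \<theta> * w 3"
      using w(2)[of 1] w(2)[of 2] w(2)[of 3] unfolding Lop_simps by simp_all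
    have "real (c 2) * c 3 * (\<theta> * w 0 - b 0 * w 1) = 0"
      unfolding charpoly_backward[where w = w, OF w(1) e] by (rule 0)
    then have "b 0 * w 1 = \<theta> * w 0" using c_pos[of 2] c_pos[of 3] by simp
    then have "eigseq \<theta> w" using e unfolding eigseq_iff by blast
    then show "adj_eigenvalue V E \<theta>" unfolding adj_eigenvalue_iff using w(1) by blast
  qed
  then show ?thesis unfolding adj_spectrum_def by blast
qed

text \<open>This shows that \<open>charpoly\<close> is not zero and supplies the right end of a sign
  change.\<close>

lemma charpoly_b0_pos: "poly charpoly (b 0) > 0"
proof -
  have p: "real (b 1) > 0" "real (b 2) > 0" "real (c 2) > 0" "real (c 3) > 0"
    using b_pos c_pos by auto
  have "poly charpoly (b 0) = real (b 0) * (real (b 1) * (real (b 2) + c 3) + real (c 2) * c 3) + real (c 2) * c 3"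
    by (simp add: poly_charpoly algebra_simps)
  also have "\<dots> > 0" using p by (intro add_nonneg_pos mult_nonneg_nonneg mult_pos_pos add_nonneg_nonneg) simp_all
  finally show ?thesis .
qed

lemma finite_spectrum: "finite (adj_spectrum V E)"
proof -
  have "charpoly \<noteq> 0" using charpoly_b0_pos by auto
  then have "[:- real (b 0), 1:] * charpoly \<noteq> 0" unfolding mult_eq_0_iff by simp
  then have "finite {\<theta>. poly ([:- real (b 0), 1:] * charpoly) \<theta> = 0}" by (rule poly_roots_finite)
  moreover have "poly ([:- real (b 0), 1:] * charpoly) \<theta> = (\<theta> - b 0) * poly charpoly \<theta>" for \<theta>
    unfolding poly_mult by simp
  ultimately show ?thesis unfolding adj_spectrum_eq by (simp only:)
qed

text \<open>Needed so that the maximum in \<open>second_largest_eig\<close> is taken over a nonempty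
  set. A root lies between \<open>- 3*k\<close>, where \<open>charpoly\<close> is negative, and
  \<open>k\<close>.\<close>

lemma ex_small_eigenvalue: "\<exists>\<theta>\<in>adj_spectrum V E. \<theta> < b 0"
proof -
  define k where "k = real (b 0)"
  have k1: "k \<ge> 1" using b_pos[of 0] by (simp add: k_def)
  have b1: "0 \<le> real (b 1)" "real (b 1) \<le> k" using a_nonneg[of 1] by (auto simp: a_eq k_def)
  have bc2: "0 \<le> real (b 2)" "0 \<le> real (c 2)" "real (b 2) + c 2 \<le> k" using a_nonneg[of 2] by (auto simp: a_eq k_def)
  have c3: "real (c 3) \<le> k" using a_nonneg[of 3] b_3 by (auto simp: a_eq k_def)
  \<comment> \<open>\<open>-X\<close> and \<open>-Y\<close> are the two diagonal factors of
    \<open>charpoly\<close> at \<open>- 3*k\<close>. Both \<open>X\<close> and \<open>Y\<close> are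
    at least \<open>2 * k\<close>, so \<open>X * Y\<close> dominates \<open>b 2 * c 2\<close>, which
    is at most \<open>k * k\<close>.\<close>
  define X where "X = -(- 3*k - k + b 1 + c 2)"
  define Y where "Y = -(- 3*k - k + b 2 + c 3)"
  have X: "X \<ge> 2 * k" and Y: "Y \<ge> 2 * k" using b1 bc2 c3 by (auto simp: X_def Y_def)
  have XY: "X * Y \<ge> 2 * k * Y" using X Y k1 by (intro mult_right_mono) auto
  have kY: "k * Y \<ge> k * (2 * k)" using Y k1 by (intro mult_left_mono) auto
  have "real (b 2) * c 2 \<le> k * k" using bc2 by (intro mult_mono) auto
  then have "X * Y - real (b 2) * c 2 \<ge> k * Y" using XY kY zero_le_square[of k] by linarith
  then have "(3*k - 1) * (X * Y - real (b 2) * c 2) \<ge> (3*k-1) * (k * Y)"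
    using k1 by (intro mult_left_mono) auto
  moreover have "(3*k-1) * (k * Y) \<ge> 2 * (k * Y)" using k1 Y by (intro mult_right_mono) auto
  moreover have "real (b 1) * Y \<le> k * Y" using b1 Y k1 by (intro mult_right_mono) auto
  moreover have "k * Y > 0" using k1 Y by (intro mult_pos_pos) auto
  moreover have "poly charpoly (- 3*k) = - ((3*k-1) * (X * Y - real (b 2) * c 2)) + real (b 1) * Y"
    by (simp add: poly_charpoly X_def Y_def k_def algebra_simps)
  ultimately have "poly charpoly (- 3*k) < 0" by linarith
  then obtain r :: real where "r < b 0" "poly charpoly r = 0"
    using poly_IVT_pos[of "- 3*k" "real (b 0)" charpoly] charpoly_b0_pos k1 by (auto simp: k_def)
  then show ?thesis unfolding adj_spectrum_eq by auto
qed

lemma second_largest_in_spectrum: "second_largest_eig V E \<in> adj_spectrum V E"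
proof -
  let ?S = "adj_spectrum V E"
  obtain r where r: "r \<in> ?S" "r < b 0" using ex_small_eigenvalue by blast
  have "real (b 0) \<in> ?S" unfolding adj_spectrum_eq by simp
  then have "r \<noteq> Max ?S" using Max_ge[OF finite_spectrum, of "real (b 0)"] r(2) by auto
  then have "?S - {Max ?S} \<noteq> {}" using r(1) by blast
  then have "Max (?S - {Max ?S}) \<in> ?S - {Max ?S}" using finite_spectrum by (intro Max_in) auto
  then show ?thesis unfolding second_largest_eig_def by simp
qed

end

section \<open>Shilla graphs\<close>

locale shilla_drg = drg3 +
  assumes second_eig: "second_largest_eig V E = a 3"
begin

section \<open>Intersection numbers and eigenvalues of a Shilla graph\<close>

definition \<beta> :: real where "\<beta> = a 3 - a 1"

abbreviation \<alpha> :: real where "\<alpha> \<equiv> a 3"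

text \<open>For the eigenvalue \<open>a 3\<close>, row 3 forces \<open>u 2 = 0\<close>, row 2 then
  gives \<open>u 1 \<noteq> 0\<close>, and rows 1 and 0 yield the valency.\<close>

lemma b0_eq: "real (b 0) = \<alpha> * \<beta>"
proof -
  have "\<alpha> \<in> adj_spectrum V E" using second_largest_in_spectrum second_eig by simp
  then obtain u where u: "eigseq \<alpha> u" "u 3 = 1" unfolding adj_spectrum_def adj_eigenvalue_iff by blast
  note e = u(1)[unfolded eigseq_iff]
  have c: "c 3 > 0" "c 2 > 0" "b 2 > 0" using c_pos[of 3] c_pos[of 2] b_pos[of 2] by auto
  have "u 2 = 0" using e u(2) c by simp
  have "real (c 2) * u 1 = - b 2" using e u(2) \<open>u 2 = 0\<close> by simp
  then have u1: "u 1 \<noteq> 0" using c by auto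
  have u0: "u 0 = (\<alpha> - a 1) * u 1" using e \<open>u 2 = 0\<close> by (simp add: algebra_simps del: One_nat_def)
  have "b 0 * u 1 = \<alpha> * u 0" using e by blast
  then have "b 0 * u 1 = (\<alpha> * \<beta>) * u 1" unfolding u0 \<beta>_def by simp
  then show ?thesis using u1 by simp
qed

lemma a1_eq: "a 1 = \<alpha> - \<beta>" by (simp add: \<beta>_def)

lemma c3_eq: "real (c 3) = \<alpha> * (\<beta> - 1)"
proof -
  have "real (c 3) = b 0 - \<alpha>" using a_eq[of 3] b_3 by simp
  then show ?thesis unfolding b0_eq by (simp add: algebra_simps)
qed

lemma b1_eq: "real (b 1) = (\<alpha> + 1) * (\<beta> - 1)"
proof -
  have "real (b 1) = real (b 0) - 1 - a 1" using a_eq[of 1] c_1 by simp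
  then show ?thesis unfolding b0_eq a1_eq by (simp add: algebra_simps)
qed

lemma a2_eq: "a 2 = \<alpha> * \<beta> - b 2 - c 2" using a_eq[of 2] b0_eq by simp

lemma \<alpha>_pos: "\<alpha> > 0" and \<beta>_pos: "\<beta> > 0" and \<beta>_gt_1: "\<beta> > 1"
proof -
  have "0 < \<alpha> * \<beta>" using b0_eq b_pos[of 0] by (metis of_nat_0_less_iff zero_less_numeral)
  then show \<alpha>: "\<alpha> > 0" and "\<beta> > 0" using a_nonneg[of 3] by (auto simp: zero_less_mult_iff)
  have "0 < (\<alpha> + 1) * (\<beta> - 1)" using b1_eq b_pos[of 1] by (metis of_nat_0_less_iff one_less_numeral_iff semiring_norm(77))
  then show "\<beta> > 1" using \<alpha> by (auto simp: zero_less_mult_iff)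
qed

lemma b2_pos: "real (b 2) > 0" and c2_pos: "real (c 2) > 0"
  using b_pos[of 2] c_pos[of 2] by auto

text \<open>Removing \<open>\<theta> - \<alpha>\<close> from \<open>charpoly\<close> leaves a
  quadratic in \<open>\<theta> + \<beta>\<close> with root sum \<open>S\<close> and root product
  \<open>- (\<beta> - 1) * c 2\<close>.\<close>

definition S :: real where "S = \<alpha> + \<beta> - b 2 - c 2"

text \<open>The remaining eigenvalues are \<open>-(\<beta> + y)\<close> and \<open>y + S - \<beta>\<close>.\<close>

definition y :: real where "y = (sqrt (S\<^sup>2 + 4 * ((\<beta> - 1) * c 2)) - S) / 2"

lemma y_root: "y\<^sup>2 + S * y = (\<beta> - 1) * c 2" and y_pos: "y > 0"
proof -
  define P where "P = (\<beta> - 1) * c 2"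
  have P: "P > 0" using \<beta>_gt_1 c2_pos by (simp add: P_def)
  define r where "r = sqrt (S\<^sup>2 + 4 * P)"
  have "r\<^sup>2 = S\<^sup>2 + 4 * P" using P by (simp add: r_def)
  moreover have yr: "y = (r - S) / 2" by (simp add: y_def r_def P_def)
  moreover have "4 * (y\<^sup>2 + S * y) = r\<^sup>2 - S\<^sup>2"
    unfolding yr by (simp add: power2_eq_square field_simps)
  ultimately show "y\<^sup>2 + S * y = (\<beta> - 1) * c 2" by (simp add: P_def)
  have "\<bar>S\<bar> < r" unfolding r_def using P by (intro real_less_rsqrt) simp
  then show "y > 0" using yr by simp
qed

lemma y_root': "(\<beta> - 1) * c 2 = y * (y + S)"
  unfolding y_root[symmetric] by (simp add: power2_eq_square algebra_simps)

lemma yS_pos: "y + S > 0"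
proof -
  have "y * (y + S) > 0" unfolding y_root'[symmetric] using \<beta>_gt_1 c2_pos by simp
  then show ?thesis using y_pos by (simp add: zero_less_mult_iff)
qed

lemma charpoly_factor:
  fixes \<theta> :: real
  shows "poly charpoly \<theta> = (\<theta> - \<alpha>) * ((\<theta> + \<beta> + y) * (\<theta> + \<beta> - (y + S)))"
proof -
  have "(\<theta> + \<beta> + y) * (\<theta> + \<beta> - (y + S)) = (\<theta> + \<beta>) * (\<theta> + \<beta> - S) - (y\<^sup>2 + S * y)"
    by (simp add: algebra_simps power2_eq_square)
  also have "\<dots> = (\<theta> + \<beta>) * (\<theta> - \<alpha> + b 2 + c 2) - (\<beta> - 1) * c 2"
    unfolding y_root by (simp add: S_def algebra_simps)
  finally have eq: "(\<theta> + \<beta> + y) * (\<theta> + \<beta> - (y + S)) = (\<theta> + \<beta>) * (\<theta> - \<alpha> + b 2 + c 2) - (\<beta> - 1) * c 2" .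
  show ?thesis
    unfolding poly_charpoly b0_eq b1_eq c3_eq eq by (simp add: algebra_simps)
qed

text \<open>\<open>b 0\<close> and \<open>\<alpha>\<close> are nonnegative, and
  \<open>y + S > 0\<close> puts the fourth root above \<open>- \<beta>\<close>.\<close>

lemma smallest_eig_eq: "smallest_eig V E = - (\<beta> + y)"
  unfolding smallest_eig_def
proof (rule Min_eqI[OF finite_spectrum])
  show "- (\<beta> + y) \<in> adj_spectrum V E" unfolding adj_spectrum_eq charpoly_factor by simp
  fix \<theta> assume "\<theta> \<in> adj_spectrum V E"
  then have "\<theta> = real (b 0) \<or> \<theta> = \<alpha> \<or> \<theta> = - (\<beta> + y) \<or> \<theta> = y + S - \<beta>"
    unfolding adj_spectrum_eq charpoly_factor by auto
  then show "- (\<beta> + y) \<le> \<theta>"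
    using \<alpha>_pos \<beta>_pos y_pos yS_pos of_nat_0_le_iff[of "b 0", where 'a = real]
    by (elim disjE) linarith+
qed

section \<open>Standard sequences, the Krein bound and the multiplicity\<close>

definition u :: "nat \<Rightarrow> real" where
  "u i = (if i = 0 then 1 else if i = 1 then 1 / \<beta> else if i = 2 then 0 else - real (c 2) / (\<beta> * b 2))"

text \<open>Entries 1, 2, 3 come from rows 0, 1, 3 for the eigenvalue
  \<open>- (\<beta> + y)\<close>.\<close>

definition w :: "nat \<Rightarrow> real" where
  "w i = (if i = 0 then 1 else if i = 1 then - (y + \<beta>) / (\<alpha> * \<beta>)
     else if i = 2 then y * (y + \<alpha> + \<beta>) / (\<alpha> * \<beta> * (\<alpha> + 1) * (\<beta> - 1)) else - y / (\<beta> * (\<alpha> + 1)))"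

lemma eigseq_u: "eigseq \<alpha> u"
  unfolding eigseq_iff b0_eq a1_eq using \<beta>_pos b2_pos c2_pos
  by (simp add: u_def field_simps)

lemma b2_S: "real (b 2) = \<alpha> + \<beta> - S - c 2" by (simp add: S_def)

text \<open>Rows 0, 1, 3 hold identically in \<open>y\<close>; row 2 is where the quadratic equation
  for \<open>y\<close> enters.\<close>

lemma eigseq_w: "eigseq (- (\<beta> + y)) w"
proof -
  have nz: "\<alpha> \<noteq> 0" "\<beta> \<noteq> 0" "\<alpha> + 1 \<noteq> 0" "\<beta> - 1 \<noteq> 0" using \<alpha>_pos \<beta>_gt_1 by auto
  have w: "w 0 = 1" "w 1 = - (y + \<beta>) / (\<alpha> * \<beta>)"
    "w 2 = y * (y + \<alpha> + \<beta>) / (\<alpha> * \<beta> * (\<alpha> + 1) * (\<beta> - 1))" "w 3 = - y / (\<beta> * (\<alpha> + 1))"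
    by (simp_all add: w_def)
  define p where "p = \<alpha> + 1"
  define q where "q = \<beta> - 1"
  \<comment> \<open>A common denominator, which turns the remaining rows into polynomial
    identities.\<close>
  define D where "D = \<alpha> * \<beta> * p * q"
  have D: "D \<noteq> 0" using nz by (simp add: D_def p_def q_def)
  have wD: "D * w 1 = - (y + \<beta>) * p * q" "D * w 2 = y * (y + \<alpha> + \<beta>)" "D * w 3 = - y * \<alpha> * q"
    unfolding w using nz by (simp_all add: D_def p_def[symmetric] q_def[symmetric])
  have 0: "b 0 * w 1 = - (\<beta> + y) * w 0" using nz unfolding b0_eq w by (simp add: field_simps)
  have 3: "c 3 * w 2 + a 3 * w 3 = - (\<beta> + y) * w 3"
  proof -
    have "D * (c 3 * w 2 + a 3 * w 3) = c 3 * (D * w 2) + a 3 * (D * w 3)" by (simp add: algebra_simps)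
    also have "\<dots> = - (\<beta> + y) * (D * w 3)" unfolding wD c3_eq q_def by (simp add: algebra_simps)
    finally show ?thesis using D by simp
  qed
  have 1: "w 0 + a 1 * w 1 + b 1 * w 2 = - (\<beta> + y) * w 1"
  proof -
    have "D * (w 0 + a 1 * w 1 + b 1 * w 2) = D + a 1 * (D * w 1) + b 1 * (D * w 2)"
      by (simp add: w(1) algebra_simps)
    also have "\<dots> = - (\<beta> + y) * (D * w 1)"
      unfolding wD unfolding b1_eq a1_eq D_def q_def p_def by (simp add: algebra_simps)
    finally show ?thesis using D by simp
  qed
  have 2: "c 2 * w 1 + a 2 * w 2 + b 2 * w 3 = - (\<beta> + y) * w 2"
  proof -
    have q2: "q * c 2 = y * (y + S)" using y_root' by (simp add: q_def)
    have "D * (c 2 * w 1 + a 2 * w 2 + b 2 * w 3) = c 2 * (D * w 1) + a 2 * (D * w 2) + b 2 * (D * w 3)"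
      by (simp add: algebra_simps)
    also have "\<dots> = - (y + \<beta>) * p * (q * c 2) + (\<alpha> * \<beta> - (\<alpha> + \<beta> - S)) * (y * (y + \<alpha> + \<beta>))
        - y * \<alpha> * (q * (\<alpha> + \<beta> - S) - q * c 2)"
      unfolding wD a2_eq b2_S by (simp add: algebra_simps)
    also have "\<dots> = - (\<beta> + y) * (D * w 2)"
      unfolding q2 wD unfolding q_def p_def by (simp add: algebra_simps)
    finally show ?thesis using D by simp
  qed
  show ?thesis unfolding eigseq_iff using 0 1 2 3 by blast
qed

lemma sphere_sizes:
  "sphere_size 0 = 1" "sphere_size 1 = \<alpha> * \<beta>" "sphere_size 2 * c 2 = \<alpha> * \<beta> * (\<alpha> + 1) * (\<beta> - 1)"
  "sphere_size 3 * c 2 = \<beta> * (\<alpha> + 1) * b 2"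
proof -
  have 2: "sphere_size 2 = real (b 0) * b 1 / c 2" using c_1 by (simp add: sphere_size_def numeral_2_eq_2 mult_ac)
  have 3: "sphere_size 3 = sphere_size 2 * (real (b 2) / c 3)"
    by (simp add: sphere_size_def numeral_3_eq_3 numeral_2_eq_2)
  show "sphere_size 0 = 1" by (simp add: sphere_size_def)
  show "sphere_size 1 = \<alpha> * \<beta>" using c_1 by (simp add: sphere_size_def b0_eq)
  show s2: "sphere_size 2 * c 2 = \<alpha> * \<beta> * (\<alpha> + 1) * (\<beta> - 1)"
    unfolding 2 b0_eq b1_eq using c2_pos by simp
  have "sphere_size 3 * c 2 = (sphere_size 2 * c 2) * b 2 / c 3" unfolding 3 by simp
  also have "\<dots> = \<beta> * (\<alpha> + 1) * b 2"
    unfolding s2 c3_eq using \<alpha>_pos \<beta>_gt_1 by (simp add: field_simps)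
  finally show "sphere_size 3 * c 2 = \<beta> * (\<alpha> + 1) * b 2" .
qed

lemma sum_le_3: "(\<Sum>i\<le>3. f i) = f 0 + f 1 + f 2 + (f 3 :: real)" for f :: "nat \<Rightarrow> real"
  by (simp add: numeral_3_eq_3 numeral_2_eq_2)

text \<open>The Krein condition for \<open>u\<close>, \<open>u\<close>, \<open>w\<close>. Index 2
  drops out because \<open>u 2 = 0\<close>, and the factor \<open>\<beta>\<^sup>2 * b 2\<close>
  clears denominators.\<close>

lemma krein_bound: "y * (real (b 2) + c 2) \<le> (\<beta>\<^sup>2 - \<beta>) * b 2"
proof -
  have "0 \<le> (\<Sum>i\<le>3. sphere_size i * (u i * u i * w i))"
    by (rule krein_nonneg[OF eigseq_u _ eigseq_u _ eigseq_w]) (simp_all add: u_def w_def)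
  also have "\<dots> = 1 + (\<alpha> * \<beta>) * (1 / \<beta> * (1 / \<beta>) * (- (y + \<beta>) / (\<alpha> * \<beta>)))
     + sphere_size 3 * (c 2 / (\<beta> * b 2) * (c 2 / (\<beta> * b 2)) * (- y / (\<beta> * (\<alpha> + 1))))"
    unfolding sum_le_3 sphere_sizes(1,2) by (simp add: u_def w_def)
  also have "sphere_size 3 = \<beta> * (\<alpha> + 1) * b 2 / c 2"
    using sphere_sizes(4) c2_pos by (simp add: field_simps)
  also have "1 + (\<alpha> * \<beta>) * (1 / \<beta> * (1 / \<beta>) * (- (y + \<beta>) / (\<alpha> * \<beta>)))
     + \<beta> * (\<alpha> + 1) * b 2 / c 2 * (c 2 / (\<beta> * b 2) * (c 2 / (\<beta> * b 2)) * (- y / (\<beta> * (\<alpha> + 1))))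
     = 1 - (y + \<beta>) / \<beta>\<^sup>2 - c 2 * y / (\<beta>\<^sup>2 * b 2)"
  proof -
    have nz: "\<alpha> \<noteq> 0" "\<beta> \<noteq> 0" "\<alpha> + 1 \<noteq> 0" "real (b 2) \<noteq> 0" "real (c 2) \<noteq> 0"
      using \<alpha>_pos \<beta>_gt_1 b2_pos c2_pos by auto
    have t1: "(\<alpha> * \<beta>) * (1 / \<beta> * (1 / \<beta>) * (- z / (\<alpha> * \<beta>))) = - (z / \<beta>\<^sup>2)" for z
      using nz by (simp add: power2_eq_square)
    have t2: "\<beta> * (\<alpha> + 1) * b 2 / c 2 * (c 2 / (\<beta> * b 2) * (c 2 / (\<beta> * b 2)) * (- y / (\<beta> * (\<alpha> + 1))))
        = - (c 2 * y / (\<beta>\<^sup>2 * b 2))"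
      using nz by (simp add: power2_eq_square)
    show ?thesis unfolding t1 t2 by (simp only: diff_conv_add_uminus)
  qed
  finally have "0 \<le> (\<beta>\<^sup>2 * b 2) * (1 - (y + \<beta>) / \<beta>\<^sup>2 - c 2 * y / (\<beta>\<^sup>2 * b 2))"
    using b2_pos by (intro mult_nonneg_nonneg) auto
  also have "\<dots> = \<beta>\<^sup>2 * b 2 - (y + \<beta>) * b 2 - c 2 * y"
    using \<beta>_pos b2_pos by (simp add: right_diff_distrib)
  finally show ?thesis by (simp add: algebra_simps)
qed

text \<open>With \<open>multiplicity_nat\<close> this makes the multiplicity of the smallest
  eigenvalue an explicit function of \<open>y\<close>.\<close>

lemma wnorm_w:
  "wnorm w * (\<alpha> * \<beta> * (\<alpha> + 1) * (S + y)) = (\<alpha> * \<beta> + \<beta> + y) * (\<alpha> + \<beta> + y) * (S + 2 * y)"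
proof -
  have nz: "\<alpha> \<noteq> 0" "\<beta> \<noteq> 0" "\<alpha> + 1 \<noteq> 0" "\<beta> - 1 \<noteq> 0" "real (c 2) \<noteq> 0"
    using \<alpha>_pos \<beta>_gt_1 c2_pos by auto
  define X where "X = \<alpha> * \<beta> * (\<alpha> + 1) * (S + y)"
  define p where "p = \<alpha> + 1"
  define q where "q = \<beta> - 1"
  define g where "g = real (c 2)"
  have w: "w 0 = 1" "w 1 = - (y + \<beta>) / (\<alpha> * \<beta>)"
    "w 2 = y * (y + \<alpha> + \<beta>) / (\<alpha> * \<beta> * p * q)" "w 3 = - y / (\<beta> * p)"
    by (simp_all add: w_def p_def q_def)
  have s: "sphere_size 2 = \<alpha> * \<beta> * p * q / g" "sphere_size 3 = \<beta> * p * b 2 / g"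
    using sphere_sizes(3,4) nz(5) by (simp_all add: field_simps p_def q_def g_def)
  have nz': "p \<noteq> 0" "q \<noteq> 0" "g \<noteq> 0" using nz by (simp_all add: p_def q_def g_def)
  \<comment> \<open>In this form \<open>S + y\<close> cancels the \<open>c 2\<close> and
    \<open>\<beta> - 1\<close> left in the denominators of the weighted squares.\<close>
  have Sy: "S + y = q * g / y" using y_root' y_pos by (simp add: q_def g_def field_simps)
  have t1: "\<alpha> * \<beta> * (w 1)\<^sup>2 * X = (y + \<beta>)\<^sup>2 * (\<alpha> + 1) * (S + y)"
  proof -
    have "(w 1)\<^sup>2 = (y + \<beta>)\<^sup>2 / (\<alpha> * \<beta>)\<^sup>2"
      unfolding w(2) power_divide power2_minus ..
    then show ?thesis unfolding X_def using nz(1,2) by (simp add: power2_eq_square)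
  qed
  have t2: "sphere_size 2 * (w 2)\<^sup>2 * X = y * (y + \<alpha> + \<beta>)\<^sup>2"
    unfolding X_def w s Sy p_def[symmetric] using nz(1,2) nz' y_pos
    by (simp add: power2_eq_square)
  have t3: "sphere_size 3 * (w 3)\<^sup>2 * X = \<alpha> * y * b 2 * q"
    unfolding X_def w s Sy p_def[symmetric] using nz(1,2) nz' y_pos
    by (simp add: power2_eq_square)
  have "wnorm w * X = X + \<alpha> * \<beta> * (w 1)\<^sup>2 * X + sphere_size 2 * (w 2)\<^sup>2 * X + sphere_size 3 * (w 3)\<^sup>2 * X"
    unfolding wnorm_def sum_le_3 sphere_sizes(1,2) w(1) by (simp add: algebra_simps)
  also have "\<dots> = X + (y + \<beta>)\<^sup>2 * (\<alpha> + 1) * (S + y) + y * (y + \<alpha> + \<beta>)\<^sup>2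
      + \<alpha> * y * (q * (\<alpha> + \<beta> - S) - (\<beta> - 1) * c 2)"
    unfolding t1 t2 t3 b2_S by (simp add: q_def algebra_simps)
  also have "\<dots> = (\<alpha> * \<beta> + \<beta> + y) * (\<alpha> + \<beta> + y) * (S + 2 * y)"
    unfolding y_root' X_def q_def by (simp add: algebra_simps power2_eq_square)
  finally show ?thesis unfolding X_def .
qed

section \<open>The coclique bound for Shilla graphs and the conclusion\<close>

lemma shilla_b_eq: "real_of_int (shilla_b b c) = \<beta>"
  by (simp add: shilla_b_def \<beta>_def a_def)

text \<open>\<open>claw_bound\<close> with \<open>m = \<beta>\<close> applies, since \<open>\<beta>
  * (a 1 + 1) = \<alpha> * \<beta> - \<beta> * (\<beta> - 1) < b 0\<close>. The factor 2 clears the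
  binomial coefficient.\<close>

lemma claw_bound_shilla:
  fixes A Bt :: int
  assumes A: "A = isect_a b c 3" and Bt: "Bt = shilla_b b c"
  shows "2 * (A - Bt\<^sup>2 + 1) \<le> (int (c 2) - 1) * (Bt * (Bt + 1))"
proof -
  have rA: "real_of_int A = \<alpha>" and rB: "real_of_int Bt = \<beta>" using A Bt by (simp_all add: a_def shilla_b_eq)
  have "Bt > 1" using \<beta>_gt_1 rB by linarith
  then have "0 \<le> Bt" by simp
  then obtain m where m: "Bt = int m" using zero_le_imp_eq_int[of Bt] by blast
  have "A - Bt \<ge> 0" using a_nonneg[of 1] a1_eq rA rB by simp
  then obtain r where r: "A - Bt = int r" using zero_le_imp_eq_int[of "A - Bt"] by blast
  have a1: "a 1 = real r" using a1_eq arg_cong[OF r, of real_of_int] by (simp add: rA rB)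
  have "real_of_int (int (b 0)) = real_of_int (A * Bt)" by (simp add: rA rB b0_eq)
  then have b0: "int (b 0) = A * Bt" by (simp only: of_int_eq_iff)
  have Ar: "A = int r + int m" using r m by simp
  have "int m * int m > int m" using m \<open>Bt > 1\<close> by simp
  then have "int (m * (r + 1)) < int (b 0)" unfolding b0 Ar m by (simp add: algebra_simps)
  then have "m * (r + 1) < b 0" by (simp only: of_nat_less_iff)
  from claw_bound[OF a1 this] have "int (Suc m * (r + 1)) \<le> int (b 0 + (Suc m choose 2) * (c 2 - 1))" by (simp only: of_nat_le_iff)
  moreover have "int (c 2 - 1) = int (c 2) - 1" using c2_pos by (simp add: of_nat_diff)
  ultimately have "(int m + 1) * (int r + 1) \<le> int (b 0) + int (Suc m choose 2) * (int (c 2) - 1)"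
    by (simp only: of_nat_add of_nat_mult of_nat_Suc of_nat_1 add.commute[of 1])
  then have "2 * ((int m + 1) * (int r + 1)) \<le> 2 * int (b 0) + (2 * int (Suc m choose 2)) * (int (c 2) - 1)"
    by simp
  moreover have "2 * int (Suc m choose 2) = (int m + 1) * int m"
  proof -
    have "2 * (Suc m choose 2) = Suc m * m" by (simp add: choose_two)
    then have "int (2 * (Suc m choose 2)) = int (Suc m * m)" by (simp only:)
    then show ?thesis by (simp add: algebra_simps)
  qed
  ultimately have "2 * ((int m + 1) * (int r + 1)) \<le> 2 * int (b 0) + ((int m + 1) * int m) * (int (c 2) - 1)"
    by (simp only:)
  then show ?thesis unfolding b0 m Ar by (simp add: algebra_simps power2_eq_square)
qed

text \<open>The inequality says \<open>y > \<beta>\<^sup>2 - \<beta> - 2\<close>. For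
  \<open>\<beta> = 2\<close> this is \<open>y > 0\<close>; the integer \<open>\<beta>\<close>
  exceeds 1, and from 3 on the parameters are infeasible.\<close>

lemma smallest_eig_bound_iff:
  "smallest_eig V E < 2 - (real_of_int (shilla_b b c))\<^sup>2 \<longleftrightarrow> shilla_b b c = 2"
proof
  assume "shilla_b b c = 2"
  then show "smallest_eig V E < 2 - (real_of_int (shilla_b b c))\<^sup>2"
    using shilla_b_eq y_pos by (simp add: smallest_eig_eq)
next
  assume lt: "smallest_eig V E < 2 - (real_of_int (shilla_b b c))\<^sup>2"
  define A where "A = isect_a b c 3"
  define Bt where "Bt = shilla_b b c"
  have rA: "real_of_int A = \<alpha>" and rB: "real_of_int Bt = \<beta>"
    by (simp_all add: A_def Bt_def a_def shilla_b_eq)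
  show "shilla_b b c = 2"
  proof (rule ccontr)
    assume "shilla_b b c \<noteq> 2"
    moreover have "Bt > 1" using \<beta>_gt_1 rB by linarith
    ultimately have B3: "Bt \<ge> 3" by (simp add: Bt_def)
    have A1: "A \<ge> 1" using \<alpha>_pos rA by linarith
    obtain x where x: "x \<in> V" using Vne by blast
    define k2 where "k2 = int (card {z\<in>V. d x z = 2})"
    define k3 where "k3 = int (card {z\<in>V. d x z = 3})"
    have k: "real_of_int k2 = sphere_size 2" "real_of_int k3 = sphere_size 3"
      by (simp_all add: k2_def k3_def card_sphere[OF x])
    obtain n :: nat where n: "n * wnorm w = (\<Sum>i\<le>3. sphere_size i)"
      using multiplicity_nat[OF eigseq_w] by (auto simp: w_def)
    have S: "real_of_int (A + Bt - int (b 2) - int (c 2)) = S" by (simp add: rA rB S_def)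
    show False
    proof (rule no_parameters_below_bound[OF B3 A1])
      show "1 \<le> int (b 2)" "1 \<le> int (c 2)" using b2_pos c2_pos by simp_all
      show "real_of_int (Bt\<^sup>2 - Bt - 2) < y"
        using lt unfolding smallest_eig_eq shilla_b_eq by (simp add: rB)
      show "y\<^sup>2 + real_of_int (A + Bt - int (b 2) - int (c 2)) * y = real_of_int ((Bt - 1) * int (c 2))"
        unfolding S using y_root by (simp add: rB)
      show "y * real_of_int (int (b 2) + int (c 2)) \<le> real_of_int ((Bt\<^sup>2 - Bt) * int (b 2))"
        using krein_bound by (simp add: rB)
      show "2 * (A - Bt\<^sup>2 + 1) \<le> (int (c 2) - 1) * (Bt * (Bt + 1))"
        by (rule claw_bound_shilla[OF A_def Bt_def])
      have "real_of_int (k2 * int (c 2)) = real_of_int (A * Bt * (A + 1) * (Bt - 1))"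
        using sphere_sizes(3) by (simp add: rA rB k)
      then show "k2 * int (c 2) = A * Bt * (A + 1) * (Bt - 1)" by (simp only: of_int_eq_iff)
      have "real_of_int (k3 * int (c 2)) = real_of_int (Bt * (A + 1) * int (b 2))"
        using sphere_sizes(4) by (simp add: rA rB k)
      then show "k3 * int (c 2) = Bt * (A + 1) * int (b 2)" by (simp only: of_int_eq_iff)
      have "real n * ((\<alpha> * \<beta> + \<beta> + y) * (\<alpha> + \<beta> + y) * (S + 2 * y))
          = (n * wnorm w) * (\<alpha> * \<beta> * (\<alpha> + 1) * (S + y))"
        unfolding wnorm_w[symmetric] by simp
      also have "n * wnorm w = 1 + \<alpha> * \<beta> + k2 + k3"
        unfolding n sum_le_3 sphere_sizes(1,2) k by simp
      finally show "real_of_int (int n) * ((real_of_int (A * Bt + Bt) + y) * (real_of_int (A + Bt) + y)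
          * (real_of_int (A + Bt - int (b 2) - int (c 2)) + 2 * y)) =
          real_of_int (1 + A * Bt + k2 + k3) * (real_of_int (A * Bt * (A + 1)) * (real_of_int (A + Bt - int (b 2) - int (c 2)) + y))"
        unfolding S by (simp add: rA rB mult.assoc)
    qed
  qed
qed

end

theorem theorem20:
  fixes V :: "'a set" and E :: "'a \<Rightarrow> 'a \<Rightarrow> bool" and b c :: "nat \<Rightarrow> nat"
  assumes "shilla V E b c"
  shows "smallest_eig V E < 2 - (real_of_int (shilla_b b c))\<^sup>2 \<longleftrightarrow> shilla_b b c = 2"
proof -
  interpret drg3 V E b c
    using assms by unfold_locales (simp add: shilla_def)
  interpret shilla_drg V E b c
    using assms by unfold_locales (simp add: shilla_def a_def)
  show ?thesis by (rule smallest_eig_bound_iff)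
qed

end
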